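(* Let $\Lambda\in\{\mathrm{K},\mathrm{GL}\}$, let $\vec r=\langle r_0,\dots,r_{n-1}\rangle$ be a finite tuple of parameters and let $\varphi\in\mathrm{Fm}(p,\vec r)$. Then $\varphi$ is normal additive in $\Lambda$ (with respect to $p$) if and only if $\varphi$ is $\Lambda$-equivalent to a (finite, possibly empty) disjunction of $\delta$-formulas.
   Context: Modal formulas are built from propositional variables using Boolean connectives, $\bot$, $\top$, $\Diamond$ and $\Box$. The variables $p$ and $q$ are distinct non-parameter variables; parameters are variables distinct from $p$ and $q$. $\mathrm{Fm}(p,\vec r)$ is the set of modal formulas containing no variables other than $p,r_0,\dots,r_{n-1}$; $\mathrm{Fm}(\vec r)$ is the set of modal formulas containing no variables other than $r_0,\dots,r_{n-1}$. A $\delta$-formula is a formula of the form $\delta_{\vec\varkappa}=\varkappa_0\wedge\Diamond(\varkappa_1\wedge\dots\wedge\Diamond(\varkappa_m\wedge p)\dots)$ with $m\ge 0$ and $\varkappa_0,\dots,\varkappa_m\in\mathrm{Fm}(\vec r)$ (for $m=0$ it is $\varkappa_0\wedge p$). For a normal modal logic $\Lambda$, formulas $\varphi,\psi$ are $\Lambda$-equivalent if $\Lambda\vdash\varphi\leftrightarrow\psi$. A formula $\varphi(p,\vec r)$ is additive in $\Lambda$ if $\Lambda\vdash\varphi(p\vee q,\vec r)\leftrightarrow\varphi(p,\vec r)\vee\varphi(q,\vec r)$, normal in $\Lambda$ if $\Lambda\vdash\varphi(\bot,\vec r)\leftrightarrow\bot$, and normal additive if it is both. $\mathrm{K}$ is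 the least normal modal logic and $\mathrm{GL}$ is the G\"odel--L\"ob logic, $\mathrm{K}$ plus $\Box(\Box p\to p)\to\Box p$. An empty disjunction is $\bot$. *)

theory Defs
  imports Main
begin

datatype fm =
    Var nat
  | Bot
  | Top
  | Neg fm
  | And fm fm
  | Or fm fm
  | Imp fm fm
  | Iff fm fm
  | Box fm
  | Dia fm

primrec vars :: "fm \<Rightarrow> nat set" where
  "vars (Var x) = {x}"
| "vars Bot = {}"
| "vars Top = {}"
| "vars (Neg \<phi>) = vars \<phi>"
| "vars (And \<phi> \<psi>) = vars \<phi> \<union> vars \<psi>"
| "vars (Or \<phi> \<psi>) = vars \<phi> \<union> vars \<psi>"
| "vars (Imp \<phi> \<psi>) = vars \<phi> \<union> vars \<psi>"
| "vars (Iff \<phi> \<psi>) = vars \<phi> \<union> vars \<psi>"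
| "vars (Box \<phi>) = vars \<phi>"
| "vars (Dia \<phi>) = vars \<phi>"

definition Fm :: "nat set \<Rightarrow> fm set" where
  "Fm X = {\<phi>. vars \<phi> \<subseteq> X}"

primrec subst :: "(nat \<Rightarrow> fm) \<Rightarrow> fm \<Rightarrow> fm" where
  "subst \<sigma> (Var x) = \<sigma> x"
| "subst \<sigma> Bot = Bot"
| "subst \<sigma> Top = Top"
| "subst \<sigma> (Neg \<phi>) = Neg (subst \<sigma> \<phi>)"
| "subst \<sigma> (And \<phi> \<psi>) = And (subst \<sigma> \<phi>) (subst \<sigma> \<psi>)"
| "subst \<sigma> (Or \<phi> \<psi>) = Or (subst \<sigma> \<phi>) (subst \<sigma> \<psi>)"
| "subst \<sigma> (Imp \<phi> \<psi>) = Imp (subst \<sigma> \<phi>) (subst \<sigma> \<psi>)"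
| "subst \<sigma> (Iff \<phi> \<psi>) = Iff (subst \<sigma> \<phi>) (subst \<sigma> \<psi>)"
| "subst \<sigma> (Box \<phi>) = Box (subst \<sigma> \<phi>)"
| "subst \<sigma> (Dia \<phi>) = Dia (subst \<sigma> \<phi>)"

abbreviation subst1 :: "nat \<Rightarrow> fm \<Rightarrow> fm \<Rightarrow> fm" where
  "subst1 p \<chi> \<phi> \<equiv> subst (Var(p := \<chi>)) \<phi>"

(* Truth-functional evaluation: formulas with a modality at the root are treated
   as atoms, with arbitrary truth values given by v. *)
primrec holds :: "(fm \<Rightarrow> bool) \<Rightarrow> fm \<Rightarrow> bool" where
  "holds v (Var x) = v (Var x)"
| "holds v Bot = False"
| "holds v Top = True"
| "holds v (Neg \<phi>) = (\<not> holds v \<phi>)"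
| "holds v (And \<phi> \<psi>) = (holds v \<phi> \<and> holds v \<psi>)"
| "holds v (Or \<phi> \<psi>) = (holds v \<phi> \<or> holds v \<psi>)"
| "holds v (Imp \<phi> \<psi>) = (holds v \<phi> \<longrightarrow> holds v \<psi>)"
| "holds v (Iff \<phi> \<psi>) = (holds v \<phi> \<longleftrightarrow> holds v \<psi>)"
| "holds v (Box \<phi>) = v (Box \<phi>)"
| "holds v (Dia \<phi>) = v (Dia \<phi>)"

definition tautology :: "fm \<Rightarrow> bool" where
  "tautology \<phi> \<longleftrightarrow> (\<forall>v. holds v \<phi>)"

(* A logic is identified with its set of theorems.  Box and Dia are both
   primitive, so their duality is part of the definition. *)
definition normal_logic :: "fm set \<Rightarrow> bool" where
  "normal_logic L \<longleftrightarrow>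
     (\<forall>\<phi>. tautology \<phi> \<longrightarrow> \<phi> \<in> L) \<and>
     (\<forall>\<phi> \<psi>. Imp (Box (Imp \<phi> \<psi>)) (Imp (Box \<phi>) (Box \<psi>)) \<in> L) \<and>
     (\<forall>\<phi>. Iff (Dia \<phi>) (Neg (Box (Neg \<phi>))) \<in> L) \<and>
     (\<forall>\<phi> \<psi>. Imp \<phi> \<psi> \<in> L \<longrightarrow> \<phi> \<in> L \<longrightarrow> \<psi> \<in> L) \<and>
     (\<forall>\<phi>. \<phi> \<in> L \<longrightarrow> Box \<phi> \<in> L) \<and>
     (\<forall>\<phi> \<sigma>. \<phi> \<in> L \<longrightarrow> subst \<sigma> \<phi> \<in> L)"

definition logic_K :: "fm set" where
  "logic_K = \<Inter>{L. normal_logic L}"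

definition logic_GL :: "fm set" where
  "logic_GL = \<Inter>{L. normal_logic L \<and>
     Imp (Box (Imp (Box (Var 0)) (Var 0))) (Box (Var 0)) \<in> L}"

definition equivalent_in :: "fm set \<Rightarrow> fm \<Rightarrow> fm \<Rightarrow> bool" where
  "equivalent_in L \<phi> \<psi> \<longleftrightarrow> Iff \<phi> \<psi> \<in> L"

(* Only meaningful when q is distinct from p and does not occur in the formula. *)
definition additive_in :: "fm set \<Rightarrow> nat \<Rightarrow> nat \<Rightarrow> fm \<Rightarrow> bool" where
  "additive_in L p q \<phi> \<longleftrightarrow>
     Iff (subst1 p (Or (Var p) (Var q)) \<phi>) (Or \<phi> (subst1 p (Var q) \<phi>)) \<in> L"

definition normal_in :: "fm set \<Rightarrow> nat \<Rightarrow> fm \<Rightarrow> bool" where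
  "normal_in L p \<phi> \<longleftrightarrow> Iff (subst1 p Bot \<phi>) Bot \<in> L"

definition normal_additive_in :: "fm set \<Rightarrow> nat \<Rightarrow> nat \<Rightarrow> fm \<Rightarrow> bool" where
  "normal_additive_in L p q \<phi> \<longleftrightarrow> normal_in L p \<phi> \<and> additive_in L p q \<phi>"

(* The nonempty sequence of coefficients is split into its head and its tail. *)
primrec delta :: "nat \<Rightarrow> fm \<Rightarrow> fm list \<Rightarrow> fm" where
  "delta p \<kappa> [] = And \<kappa> (Var p)"
| "delta p \<kappa> (\<kappa>' # \<kappa>s) = And \<kappa> (Dia (delta p \<kappa>' \<kappa>s))"

definition delta_formulas :: "nat \<Rightarrow> nat set \<Rightarrow> fm set" where
  "delta_formulas p R = {delta p \<kappa> \<kappa>s |\<kappa> \<kappa>s. \<kappa> \<in> Fm R \<and> set \<kappa>s \<subseteq> Fm R}"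

definition big_or :: "fm list \<Rightarrow> fm" where
  "big_or \<phi>s = foldr Or \<phi>s Bot"

end

theory Submission
  imports Defs
begin

text \<open>Both logics are complete for finite frames, the transitive irreflexive ones for \<open>GL\<close>.
  Suppose that \<open>\<phi>\<close> is normal additive and true at the root of a finite model. After unravelling,
  additivity allows one to shrink the set where \<open>p\<close> holds to a single node, and then \<open>\<phi>\<close> depends
  only on the chain from the root to this node and on the successors of the chain points, where
  \<open>p\<close> is false. Hence the truth of \<open>\<phi>\<close> is determined by the finite \<open>p\<close>-free types of the chain
  points, so by a \<open>\<delta>\<close>-formula, which conversely implies \<open>\<phi>\<close> by monotonicity. The
  chain can be taken of bounded length: by modal depth in \<open>K\<close>, and by keeping only the last
  witnesses of the subformulas in \<open>GL\<close>. So finitely many \<open>\<delta>\<close>-formulas suffice.\<close>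

section \<open>Kripke semantics\<close>

text \<open>The obstacle is that in a given model a point where \<open>p\<close> holds may be
  reached along many paths, or lie on a cycle, so singling out the point does not single out a
  chain. In the unravelling a node is reached only through its own prefixes. No other node ever
  reaches it, so all other nodes may be folded back to the points that they stand for. The result is
  \<open>chain_rel\<close>: fresh copies of the chain points over an unchanged copy of the model.
  Off the chain every modality is evaluated with \<open>Bot\<close> for \<open>p\<close>, which is
  why types consist of the formulas \<open>subst1 p Bot \<psi>\<close>. The flag \<open>tr\<close>
  treats K and GL together; they differ in whether a chain point sees all later ones or only the
  next. In K the cut-off of the unravelling depends on the formula alone. In GL it depends on the
  size of the model, hence the separate thinning of chains. Additivity is applied, through
  soundness, to frames over lists and sums, while completeness only speaks of frames over
  \<open>fm set\<close>.\<close>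

primrec sat :: "('w \<times> 'w) set \<Rightarrow> (nat \<Rightarrow> 'w set) \<Rightarrow> 'w \<Rightarrow> fm \<Rightarrow> bool" where
  "sat R V w (Var x) = (w \<in> V x)"
| "sat R V w Bot = False"
| "sat R V w Top = True"
| "sat R V w (Neg \<phi>) = (\<not> sat R V w \<phi>)"
| "sat R V w (And \<phi> \<psi>) = (sat R V w \<phi> \<and> sat R V w \<psi>)"
| "sat R V w (Or \<phi> \<psi>) = (sat R V w \<phi> \<or> sat R V w \<psi>)"
| "sat R V w (Imp \<phi> \<psi>) = (sat R V w \<phi> \<longrightarrow> sat R V w \<psi>)"
| "sat R V w (Iff \<phi> \<psi>) = (sat R V w \<phi> \<longleftrightarrow> sat R V w \<psi>)"
| "sat R V w (Box \<phi>) = (\<forall>v. (w, v) \<in> R \<longrightarrow> sat R V v \<phi>)"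
| "sat R V w (Dia \<phi>) = (\<exists>v. (w, v) \<in> R \<and> sat R V v \<phi>)"

lemma sat_subst: "sat R V w (subst \<sigma> \<phi>) = sat R (\<lambda>x. {v. sat R V v (\<sigma> x)}) w \<phi>"
  by (induction \<phi> arbitrary: w) auto

lemma sat_cong_vars:
  "(\<And>x. x \<in> vars \<phi> \<Longrightarrow> V x = U x) \<Longrightarrow> sat R V w \<phi> = sat R U w \<phi>"
  by (induction \<phi> arbitrary: w) simp_all

lemma sat_subst1: "sat R V w (subst1 p \<chi> \<phi>) = sat R (V(p := {v. sat R V v \<chi>})) w \<phi>"
  unfolding sat_subst by (rule sat_cong_vars) auto

lemma holds_sat: "holds (sat R V w) \<phi> = sat R V w \<phi>"
  by (induction \<phi>) auto

text \<open>Finiteness is asked of the relation only: points outside its field are isolated, so the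
  carrier may be an infinite type such as \<open>fm set\<close>.\<close>

definition frame :: "bool \<Rightarrow> ('w \<times> 'w) set \<Rightarrow> bool" where
  "frame tr R \<longleftrightarrow> finite R \<and> (tr \<longrightarrow> trans R \<and> irrefl R)"

definition logic :: "bool \<Rightarrow> fm set" where
  "logic tr = (if tr then logic_GL else logic_K)"

definition loeb :: "fm \<Rightarrow> fm" where
  "loeb \<phi> = Imp (Box (Imp (Box \<phi>) \<phi>)) (Box \<phi>)"

lemma normal_logic_valid: "normal_logic {\<phi>. \<forall>V w. sat R V w \<phi>}"
proof -
  have "sat R V w \<phi>" if "tautology \<phi>" for \<phi> V w
    using that holds_sat[of R V w \<phi>] by (simp add: tautology_def)
  then show ?thesis by (simp add: normal_logic_def sat_subst)
qed

text \<open>The converse of a finite acyclic relation is well-founded, so one can induct upwards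
  from the dead ends. Transitivity turns successors of \<open>v\<close> into successors of
  \<open>w\<close>, and the induction hypothesis then gives \<open>Box \<phi>\<close> at
  \<open>v\<close>.\<close>

lemma loeb_valid:
  assumes "frame True R"
  shows "sat R V w (loeb \<phi>)"
proof -
  have "acyclic R" "finite R"
    using assms by (auto simp: frame_def acyclic_irrefl trancl_id)
  then have wf: "wf (R\<inverse>)"
    by (simp add: finite_acyclic_wf_converse)
  have tr: "trans R"
    using assms by (simp add: frame_def)
  have "(w, v) \<in> R \<longrightarrow> sat R V v \<phi>" if "sat R V w (Box (Imp (Box \<phi>) \<phi>))" for v
    using wf
  proof (induction v rule: wf_induct_rule)
    case (less v)
    then show ?case using that tr by (auto dest: transD)
  qed
  then show ?thesis unfolding loeb_def sat.simps(7) sat.simps(9)[of R V w \<phi>] by blast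
qed

lemma soundness:
  assumes "frame tr R" "\<phi> \<in> logic tr"
  shows "sat R V w \<phi>"
proof -
  let ?L = "{\<phi>. \<forall>V w. sat R V w \<phi>}"
  have loeb: "loeb (Var 0) \<in> ?L" if tr
    using loeb_valid[of R] assms(1) that by simp
  have "?L \<in> {L. normal_logic L \<and> (tr \<longrightarrow> loeb (Var 0) \<in> L)}"
    by (rule CollectI, rule conjI, rule normal_logic_valid, rule impI, rule loeb)
  then have "logic tr \<subseteq> ?L"
    unfolding logic_def logic_GL_def logic_K_def loeb_def
    by (cases tr) (simp_all only: simp_thms if_True if_False Inter_lower)
  then have "\<phi> \<in> ?L" using assms(2) by (rule subsetD)
  then show ?thesis by simp
qed

section \<open>Completeness with respect to finite frames\<close>

lemma normal_logic_Inter: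
  assumes "\<And>L. L \<in> \<L> \<Longrightarrow> normal_logic L"
  shows "normal_logic (\<Inter>\<L>)"
  unfolding normal_logic_def
proof (intro conjI allI impI InterI)
  fix \<phi> \<psi> L
  assume "Imp \<phi> \<psi> \<in> \<Inter>\<L>" "\<phi> \<in> \<Inter>\<L>" "L \<in> \<L>"
  then show "\<psi> \<in> L" using assms[of L] by (auto simp: normal_logic_def)
qed (use assms in \<open>simp_all add: normal_logic_def\<close>)

lemma normal_logic_logic: "normal_logic (logic tr)"
  unfolding logic_def logic_K_def logic_GL_def
  by (cases tr) (simp_all only: if_True if_False, (rule normal_logic_Inter, simp)+)

lemma loeb_in_logic_GL: "loeb \<phi> \<in> logic True"
proof -
  have "loeb (Var 0) \<in> logic True"
    by (auto simp: logic_def logic_GL_def loeb_def)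
  then have "subst (\<lambda>_. \<phi>) (loeb (Var 0)) \<in> logic True"
    using normal_logic_logic[of True] unfolding normal_logic_def by blast
  then show ?thesis by (simp add: loeb_def)
qed

definition big_and :: "fm list \<Rightarrow> fm" where
  "big_and \<phi>s = foldr And \<phi>s Top"

lemma big_and_simps [simp]:
  "big_and [] = Top" "big_and (\<phi> # \<phi>s) = And \<phi> (big_and \<phi>s)"
  by (simp_all add: big_and_def)

lemma holds_big_and: "holds v (big_and \<phi>s) \<longleftrightarrow> (\<forall>\<phi>\<in>set \<phi>s. holds v \<phi>)"
  by (induction \<phi>s) auto

lemma sat_big_or: "sat R V w (big_or \<phi>s) \<longleftrightarrow> (\<exists>\<phi>\<in>set \<phi>s. sat R V w \<phi>)"
  by (induction \<phi>s) (auto simp: big_or_def)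

text \<open>This replaces explicit propositional derivations: membership in the logic becomes a
  claim about \<open>holds\<close>, where boxed and diamond formulas are atoms.\<close>

lemma tautological_consequence:
  assumes "normal_logic L"
  shows "set \<Gamma> \<subseteq> L \<Longrightarrow> (\<And>v. \<forall>\<gamma>\<in>set \<Gamma>. holds v \<gamma> \<Longrightarrow> holds v \<theta>) \<Longrightarrow> \<theta> \<in> L"
proof (induction \<Gamma> arbitrary: \<theta>)
  case Nil
  then show ?case using assms by (auto simp: normal_logic_def tautology_def)
next
  case (Cons \<gamma> \<Gamma>)
  then have "Imp \<gamma> \<theta> \<in> L" by auto
  then show ?case using Cons.prems(1) assms unfolding normal_logic_def by auto
qed

lemma box_regularity:
  assumes L: "normal_logic L"
  shows "Imp (big_and \<beta>s) \<chi> \<in> L \<Longrightarrow> Imp (big_and (map Box \<beta>s)) (Box \<chi>) \<in> L"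
proof (induction \<beta>s arbitrary: \<chi>)
  case Nil
  then have "\<chi> \<in> L"
    using tautological_consequence[OF L, of "[Imp Top \<chi>]" \<chi>] by simp
  then have "Box \<chi> \<in> L" using L by (simp add: normal_logic_def)
  then show ?case using tautological_consequence[OF L, of "[Box \<chi>]"] by simp
next
  case (Cons \<beta> \<beta>s)
  have "Imp (big_and \<beta>s) (Imp \<beta> \<chi>) \<in> L"
    using Cons.prems tautological_consequence[OF L, of "[Imp (big_and (\<beta> # \<beta>s)) \<chi>]"] by simp
  then have "Imp (big_and (map Box \<beta>s)) (Box (Imp \<beta> \<chi>)) \<in> L" by (rule Cons.IH)
  moreover have "Imp (Box (Imp \<beta> \<chi>)) (Imp (Box \<beta>) (Box \<chi>)) \<in> L"
    using L by (simp add: normal_logic_def)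
  ultimately show ?case
    by (intro tautological_consequence[OF L, of "[Imp (big_and (map Box \<beta>s)) (Box (Imp \<beta> \<chi>)),
      Imp (Box (Imp \<beta> \<chi>)) (Imp (Box \<beta>) (Box \<chi>))]"]) auto
qed

text \<open>The axiom 4 is an instance of Loeb's axiom for \<open>\<phi> \<and> \<box>\<phi>\<close>.\<close>

lemma four_in_logic_GL: "Imp (Box \<phi>) (Box (Box \<phi>)) \<in> logic True"
proof -
  note L = normal_logic_logic[of True]
  let ?A = "And \<phi> (Box \<phi>)"
  have mono: "Imp (Box \<alpha>) (Box \<beta>) \<in> logic True" if "Imp \<alpha> \<beta> \<in> logic True" for \<alpha> \<beta>
  proof -
    have "Imp (big_and [\<alpha>]) \<beta> \<in> logic True"
      using that tautological_consequence[OF L, of "[Imp \<alpha> \<beta>]"] by simp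
    from box_regularity[OF L this] show ?thesis
      using tautological_consequence[OF L, of "[Imp (big_and (map Box [\<alpha>])) (Box \<beta>)]"] by simp
  qed
  have 1: "Imp (Box ?A) (Box \<phi>) \<in> logic True" "Imp (Box ?A) (Box (Box \<phi>)) \<in> logic True"
    by (rule mono, rule tautological_consequence[OF L, of "[]"], simp, simp)+
  then have "Imp \<phi> (Imp (Box ?A) ?A) \<in> logic True"
    by (intro tautological_consequence[OF L, of "[Imp (Box ?A) (Box \<phi>)]"]) auto
  then have "Imp (Box \<phi>) (Box (Imp (Box ?A) ?A)) \<in> logic True" by (rule mono)
  then show ?thesis
    using 1 loeb_in_logic_GL[of ?A]
    by (intro tautological_consequence[OF L, of "[Imp (Box \<phi>) (Box (Imp (Box ?A) ?A)), loeb ?A,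
          Imp (Box ?A) (Box (Box \<phi>))]"]) (auto simp: loeb_def)
qed

section \<open>The finite canonical model\<close>

definition consistent :: "fm set \<Rightarrow> fm list \<Rightarrow> bool" where
  "consistent L \<phi>s \<longleftrightarrow> Neg (big_and \<phi>s) \<notin> L"

lemma consistent_extend:
  assumes L: "normal_logic L" and "finite \<Sigma>" and "consistent L \<phi>s"
  shows "\<exists>\<psi>s. consistent L \<psi>s \<and> set \<phi>s \<subseteq> set \<psi>s \<and> (\<forall>\<sigma>\<in>\<Sigma>. \<sigma> \<in> set \<psi>s \<or> Neg \<sigma> \<in> set \<psi>s)"
  using assms(2)
proof (induction \<Sigma> rule: finite_induct)
  case empty
  then show ?case using assms(3) by auto
next
  case (insert \<sigma> \<Sigma>)
  then obtain \<psi>s where \<psi>s: "consistent L \<psi>s" "set \<phi>s \<subseteq> set \<psi>s"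
    "\<forall>\<sigma>\<in>\<Sigma>. \<sigma> \<in> set \<psi>s \<or> Neg \<sigma> \<in> set \<psi>s" by auto
  have "consistent L (\<sigma> # \<psi>s) \<or> consistent L (Neg \<sigma> # \<psi>s)"
  proof (rule ccontr)
    assume "\<not> ?thesis"
    then have "set [Neg (big_and (\<sigma> # \<psi>s)), Neg (big_and (Neg \<sigma> # \<psi>s))] \<subseteq> L"
      by (auto simp: consistent_def)
    then have "Neg (big_and \<psi>s) \<in> L"
      by (rule tautological_consequence[OF L]) auto
    then show False using \<psi>s(1) by (simp add: consistent_def)
  qed
  then obtain \<tau> where "\<tau> = \<sigma> \<or> \<tau> = Neg \<sigma>" "consistent L (\<tau> # \<psi>s)" by auto
  then show ?case using \<psi>s by (intro exI[of _ "\<tau> # \<psi>s"]) auto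
qed

lemma consistent_valuation:
  assumes "normal_logic L" "consistent L \<phi>s" "\<theta> \<in> L"
  shows "\<exists>v. holds v \<theta> \<and> (\<forall>\<phi>\<in>set \<phi>s. holds v \<phi>)"
  using assms(2,3) tautological_consequence[OF assms(1), of "[\<theta>]" "Neg (big_and \<phi>s)"]
  by (auto simp: consistent_def holds_big_and)

text \<open>Subformulas, enlarged at each diamond by its dual box, so that \<open>canon_box\<close>
  also settles the truth of diamonds.\<close>

primrec cl :: "fm \<Rightarrow> fm set" where
  "cl (Var x) = {Var x}"
| "cl Bot = {Bot}"
| "cl Top = {Top}"
| "cl (Neg \<phi>) = insert (Neg \<phi>) (cl \<phi>)"
| "cl (And \<phi> \<psi>) = insert (And \<phi> \<psi>) (cl \<phi> \<union> cl \<psi>)"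
| "cl (Or \<phi> \<psi>) = insert (Or \<phi> \<psi>) (cl \<phi> \<union> cl \<psi>)"
| "cl (Imp \<phi> \<psi>) = insert (Imp \<phi> \<psi>) (cl \<phi> \<union> cl \<psi>)"
| "cl (Iff \<phi> \<psi>) = insert (Iff \<phi> \<psi>) (cl \<phi> \<union> cl \<psi>)"
| "cl (Box \<phi>) = insert (Box \<phi>) (cl \<phi>)"
| "cl (Dia \<phi>) = {Dia \<phi>, Box (Neg \<phi>), Neg \<phi>} \<union> cl \<phi>"

lemma self_in_cl [simp]: "\<phi> \<in> cl \<phi>"
  by (cases \<phi>) auto

lemma finite_cl [simp]: "finite (cl \<phi>)"
  by (induction \<phi>) auto

lemma vars_cl: "\<psi> \<in> cl \<phi> \<Longrightarrow> vars \<psi> \<subseteq> vars \<phi>"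
  by (induction \<phi>) auto

definition world :: "fm set \<Rightarrow> fm set \<Rightarrow> fm set \<Rightarrow> bool" where
  "world L \<Sigma> A \<longleftrightarrow> (\<exists>\<phi>s. consistent L \<phi>s \<and> (\<forall>\<sigma>\<in>\<Sigma>. \<sigma> \<in> set \<phi>s \<or> Neg \<sigma> \<in> set \<phi>s) \<and>
     A = \<Sigma> \<inter> set \<phi>s)"

text \<open>The theorem \<open>\<theta>\<close> may lie outside \<open>\<Sigma>\<close>; this is how
  the duality of \<open>Dia\<close> and \<open>Box\<close> reaches the worlds in
  \<open>canon_truth\<close>.\<close>

lemma world_valuation:
  assumes "normal_logic L" "world L \<Sigma> A" "\<theta> \<in> L"
  shows "\<exists>v. holds v \<theta> \<and> (\<forall>\<sigma>\<in>\<Sigma>. holds v \<sigma> \<longleftrightarrow> \<sigma> \<in> A)"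
proof -
  obtain \<phi>s where \<phi>s: "consistent L \<phi>s" "\<forall>\<sigma>\<in>\<Sigma>. \<sigma> \<in> set \<phi>s \<or> Neg \<sigma> \<in> set \<phi>s" "A = \<Sigma> \<inter> set \<phi>s"
    using assms(2) by (auto simp: world_def)
  obtain v where v: "holds v \<theta>" "\<forall>\<phi>\<in>set \<phi>s. holds v \<phi>"
    using consistent_valuation[OF assms(1) \<phi>s(1) assms(3)] by auto
  have "holds v \<sigma> \<longleftrightarrow> \<sigma> \<in> A" if "\<sigma> \<in> \<Sigma>" for \<sigma>
    using \<phi>s(2,3) that v(2) by fastforce
  then show ?thesis using v(1) by blast
qed

lemma world_extend:
  assumes "normal_logic L" "finite \<Sigma>" "consistent L \<phi>s"
  obtains A where "world L \<Sigma> A" "\<And>\<sigma>. \<sigma> \<in> \<Sigma> \<Longrightarrow> \<sigma> \<in> set \<phi>s \<Longrightarrow> \<sigma> \<in> A"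
    "\<And>\<sigma>. \<sigma> \<in> \<Sigma> \<Longrightarrow> Neg \<sigma> \<in> set \<phi>s \<Longrightarrow> \<sigma> \<notin> A"
proof -
  obtain \<psi>s where \<psi>s: "consistent L \<psi>s" "set \<phi>s \<subseteq> set \<psi>s"
      "\<forall>\<sigma>\<in>\<Sigma>. \<sigma> \<in> set \<psi>s \<or> Neg \<sigma> \<in> set \<psi>s"
    using consistent_extend[OF assms] by blast
  have "Top \<in> L" using assms(1) by (auto simp: normal_logic_def tautology_def)
  then obtain v where v: "\<forall>\<phi>\<in>set \<psi>s. holds v \<phi>"
    using consistent_valuation[OF assms(1) \<psi>s(1)] by blast
  show thesis
  proof (rule that[of "\<Sigma> \<inter> set \<psi>s"])
    show "world L \<Sigma> (\<Sigma> \<inter> set \<psi>s)" using \<psi>s by (auto simp: world_def)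
    show "\<sigma> \<notin> \<Sigma> \<inter> set \<psi>s" if "Neg \<sigma> \<in> set \<phi>s" for \<sigma>
    proof -
      have "holds v (Neg \<sigma>)" using v \<psi>s(2) that by blast
      then show ?thesis using v by auto
    qed
  qed (use \<psi>s in auto)
qed

text \<open>For GL this is the usual finite canonical relation: a successor keeps all boxed formulas
  and gains a new one, which forces transitivity and irreflexivity.\<close>

definition canon :: "bool \<Rightarrow> fm set \<Rightarrow> (fm set \<times> fm set) set" where
  "canon tr \<Sigma> = {(A, B). world (logic tr) \<Sigma> A \<and> world (logic tr) \<Sigma> B \<and>
     (\<forall>\<psi>. Box \<psi> \<in> A \<longrightarrow> Box \<psi> \<in> \<Sigma> \<longrightarrow> \<psi> \<in> \<Sigma> \<longrightarrow> \<psi> \<in> B) \<and>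
     (tr \<longrightarrow> (\<forall>\<psi>. Box \<psi> \<in> A \<longrightarrow> Box \<psi> \<in> B) \<and> (\<exists>\<chi>. Box \<chi> \<in> B \<and> Box \<chi> \<notin> A))}"

lemma canon_world: "(A, B) \<in> canon tr \<Sigma> \<Longrightarrow> world (logic tr) \<Sigma> B"
  by (simp add: canon_def)

lemma world_subset: "world L \<Sigma> A \<Longrightarrow> A \<subseteq> \<Sigma>"
  by (auto simp: world_def)

lemma frame_canon: "finite \<Sigma> \<Longrightarrow> frame tr (canon tr \<Sigma>)"
proof -
  assume "finite \<Sigma>"
  moreover have "canon tr \<Sigma> \<subseteq> Pow \<Sigma> \<times> Pow \<Sigma>"
    by (auto simp: canon_def dest: world_subset)
  ultimately have "finite (canon tr \<Sigma>)" by (meson finite_Pow_iff finite_SigmaI finite_subset)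
  moreover have "tr \<Longrightarrow> trans (canon tr \<Sigma>)"
    unfolding canon_def by (rule transI) (simp, blast)
  moreover have "tr \<Longrightarrow> irrefl (canon tr \<Sigma>)"
    by (auto simp: canon_def irrefl_def)
  ultimately show ?thesis by (simp add: frame_def)
qed

text \<open>If \<open>Box \<chi>\<close> is missing from \<open>A\<close>, then
  \<open>Neg \<chi> # \<xi>s\<close> describes a successor refuting \<open>\<chi>\<close>. In GL it
  also asks for \<open>Box \<chi>\<close>, the boxed formula by which the successor grows. Were the
  list inconsistent, regularity (with axiom 4 and Loeb's axiom in GL) would derive
  \<open>Box \<chi>\<close> from the boxes in \<open>A\<close>.\<close>

lemma canon_box:
  assumes fin: "finite \<Sigma>" and A: "world (logic tr) \<Sigma> A" and \<chi>: "Box \<chi> \<in> \<Sigma>" "\<chi> \<in> \<Sigma>"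
  shows "Box \<chi> \<in> A \<longleftrightarrow> (\<forall>B. (A, B) \<in> canon tr \<Sigma> \<longrightarrow> \<chi> \<in> B)"
proof
  assume "Box \<chi> \<in> A"
  then show "\<forall>B. (A, B) \<in> canon tr \<Sigma> \<longrightarrow> \<chi> \<in> B" using \<chi> by (auto simp: canon_def)
next
  note L = normal_logic_logic[of tr]
  assume all: "\<forall>B. (A, B) \<in> canon tr \<Sigma> \<longrightarrow> \<chi> \<in> B"
  show "Box \<chi> \<in> A"
  proof (rule ccontr)
    assume nA: "Box \<chi> \<notin> A"
    obtain \<phi>s where \<phi>s: "consistent (logic tr) \<phi>s"
      "\<forall>\<sigma>\<in>\<Sigma>. \<sigma> \<in> set \<phi>s \<or> Neg \<sigma> \<in> set \<phi>s" "A = \<Sigma> \<inter> set \<phi>s"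
      using A by (auto simp: world_def)
    have "finite A" using fin \<phi>s(3) by simp
    then have "finite (Box -` A)" by (rule finite_vimageI) (simp add: inj_def)
    then obtain \<beta>s where \<beta>s: "set \<beta>s = Box -` A" by (rule exE[OF finite_list])
    have hv: "holds v (Neg (Box \<chi>)) \<and> (\<forall>\<beta>\<in>set \<beta>s. holds v (Box \<beta>))"
      if "holds v (big_and \<phi>s)" for v
    proof -
      have "Neg (Box \<chi>) \<in> set \<phi>s" using \<phi>s(2,3) nA \<chi>(1) by blast
      moreover have "Box \<beta> \<in> set \<phi>s" if "\<beta> \<in> set \<beta>s" for \<beta>
        using that \<beta>s \<phi>s(3) by simp
      ultimately show ?thesis using that unfolding holds_big_and by blast
    qed
    define \<xi>s where "\<xi>s = (if tr then Box \<chi> # \<beta>s @ map Box \<beta>s else \<beta>s)"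
    have "consistent (logic tr) (Neg \<chi> # \<xi>s)"
    proof (rule ccontr)
      assume "\<not> consistent (logic tr) (Neg \<chi> # \<xi>s)"
      then have incons: "Neg (big_and (Neg \<chi> # \<xi>s)) \<in> logic tr" by (simp add: consistent_def)
      have "Neg (big_and \<phi>s) \<in> logic tr"
      proof (cases tr)
        case False
        have "Imp (big_and \<beta>s) \<chi> \<in> logic tr"
          using incons False
          by (intro tautological_consequence[OF L, of "[Neg (big_and (Neg \<chi> # \<xi>s))]"])
             (auto simp: \<xi>s_def)
        from box_regularity[OF L this] show ?thesis
          using hv
          by (intro tautological_consequence[OF L, of "[Imp (big_and (map Box \<beta>s)) (Box \<chi>)]"])
             (auto simp: holds_big_and)
      next
        case True
        let ?\<beta>s = "\<beta>s @ map Box \<beta>s" and ?\<theta> = "Imp (Box \<chi>) \<chi>"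
        have "Imp (big_and ?\<beta>s) ?\<theta> \<in> logic tr"
          using incons True
          by (intro tautological_consequence[OF L, of "[Neg (big_and (Neg \<chi> # \<xi>s))]"])
             (auto simp: \<xi>s_def)
        from box_regularity[OF L this]
        have *: "Imp (big_and (map Box ?\<beta>s)) (Box ?\<theta>) \<in> logic tr" .
        show ?thesis
        proof (rule tautological_consequence[OF L])
          show "set (Imp (big_and (map Box ?\<beta>s)) (Box ?\<theta>) # loeb \<chi> #
            map (\<lambda>\<beta>. Imp (Box \<beta>) (Box (Box \<beta>))) \<beta>s) \<subseteq> logic tr"
            using * True loeb_in_logic_GL four_in_logic_GL by auto
        next
          fix v
          assume "\<forall>\<gamma>\<in>set (Imp (big_and (map Box ?\<beta>s)) (Box ?\<theta>) # loeb \<chi> #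
            map (\<lambda>\<beta>. Imp (Box \<beta>) (Box (Box \<beta>))) \<beta>s). holds v \<gamma>"
          then show "holds v (Neg (big_and \<phi>s))"
            using hv[of v] by (auto simp: holds_big_and loeb_def)
        qed
      qed
      then show False using \<phi>s(1) by (simp add: consistent_def)
    qed
    then obtain B where B: "world (logic tr) \<Sigma> B"
      "\<And>\<sigma>. \<sigma> \<in> \<Sigma> \<Longrightarrow> \<sigma> \<in> set (Neg \<chi> # \<xi>s) \<Longrightarrow> \<sigma> \<in> B"
      "\<And>\<sigma>. \<sigma> \<in> \<Sigma> \<Longrightarrow> Neg \<sigma> \<in> set (Neg \<chi> # \<xi>s) \<Longrightarrow> \<sigma> \<notin> B"
      using world_extend[OF L fin] by metis
    have "Box \<psi> \<in> B" if "tr" "Box \<psi> \<in> A" for \<psi>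
      using B(2)[of "Box \<psi>"] that world_subset[OF A] \<beta>s by (auto simp: \<xi>s_def)
    moreover have "\<psi> \<in> B" if "Box \<psi> \<in> A" "\<psi> \<in> \<Sigma>" for \<psi>
      using B(2)[of \<psi>] that \<beta>s by (auto simp: \<xi>s_def split: if_splits)
    moreover have "Box \<chi> \<in> B" if tr
      using B(2)[of "Box \<chi>"] that \<chi> by (auto simp: \<xi>s_def)
    ultimately have "(A, B) \<in> canon tr \<Sigma>"
      using A B(1) nA by (auto simp: canon_def)
    moreover have "\<chi> \<notin> B" using B(3)[of \<chi>] \<chi> by simp
    ultimately show False using all by blast
  qed
qed

lemma world_holds:
  assumes "world (logic tr) \<Sigma> A"
  shows "\<exists>v. \<forall>\<sigma>\<in>\<Sigma>. holds v \<sigma> \<longleftrightarrow> \<sigma> \<in> A"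
proof -
  have "Top \<in> logic tr"
    using normal_logic_logic[of tr] by (simp add: normal_logic_def tautology_def)
  then show ?thesis using world_valuation[OF normal_logic_logic assms] by blast
qed

lemma canon_truth:
  assumes "finite \<Sigma>" and "cl \<phi> \<subseteq> \<Sigma>" and "world (logic tr) \<Sigma> A"
  shows "sat (canon tr \<Sigma>) (\<lambda>x. {A. Var x \<in> A}) A \<phi> \<longleftrightarrow> \<phi> \<in> A"
  using assms(2,3)
proof (induction \<phi> arbitrary: A)
  case (Box \<phi>)
  have "\<phi> \<in> \<Sigma>" using Box.prems self_in_cl[of \<phi>] by auto
  moreover have "sat (canon tr \<Sigma>) (\<lambda>x. {A. Var x \<in> A}) B \<phi> \<longleftrightarrow> \<phi> \<in> B"
    if "(A, B) \<in> canon tr \<Sigma>" for B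
    using Box.IH[of B] Box.prems canon_world[OF that] by simp
  moreover have "Box \<phi> \<in> \<Sigma>" using Box.prems by simp
  ultimately show ?case
    using canon_box[OF assms(1) Box.prems(2)] by simp
next
  case (Dia \<phi>)
  note L = normal_logic_logic[of tr]
  have mem: "\<phi> \<in> \<Sigma>" "Neg \<phi> \<in> \<Sigma>" "Box (Neg \<phi>) \<in> \<Sigma>" "Dia \<phi> \<in> \<Sigma>"
    using Dia.prems self_in_cl[of \<phi>] by auto
  have "Iff (Dia \<phi>) (Neg (Box (Neg \<phi>))) \<in> logic tr" using L by (simp add: normal_logic_def)
  from world_valuation[OF L Dia.prems(2) this] obtain v
    where v: "holds v (Iff (Dia \<phi>) (Neg (Box (Neg \<phi>))))"
      "\<And>\<sigma>. \<sigma> \<in> \<Sigma> \<Longrightarrow> holds v \<sigma> \<longleftrightarrow> \<sigma> \<in> A" by blast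
  have 1: "Dia \<phi> \<in> A \<longleftrightarrow> Box (Neg \<phi>) \<notin> A"
    using v(1) v(2)[OF mem(3)] v(2)[OF mem(4)] by simp
  have 2: "Neg \<phi> \<in> B \<longleftrightarrow> \<phi> \<notin> B" if B: "world (logic tr) \<Sigma> B" for B
  proof -
    obtain v where "\<And>\<sigma>. \<sigma> \<in> \<Sigma> \<Longrightarrow> holds v \<sigma> \<longleftrightarrow> \<sigma> \<in> B"
      using world_holds[OF B] by blast
    from this[OF mem(1)] this[OF mem(2)] show ?thesis by simp
  qed
  have "cl \<phi> \<subseteq> \<Sigma>" using Dia.prems by simp
  then have 3: "sat (canon tr \<Sigma>) (\<lambda>x. {A. Var x \<in> A}) B \<phi> \<longleftrightarrow> Neg \<phi> \<notin> B"
    if "(A, B) \<in> canon tr \<Sigma>" for B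
    using Dia.IH[of B] 2[of B] canon_world[OF that] by simp
  show ?case
    unfolding sat.simps 1 canon_box[OF assms(1) Dia.prems(2) mem(3,2)] using 3 by blast
next
  case (Neg \<phi>)
  obtain v where v: "\<And>\<sigma>. \<sigma> \<in> \<Sigma> \<Longrightarrow> holds v \<sigma> \<longleftrightarrow> \<sigma> \<in> A"
    using world_holds[OF Neg.prems(2)] by blast
  have "\<phi> \<in> \<Sigma>" "Neg \<phi> \<in> \<Sigma>"
    using Neg.prems self_in_cl[of \<phi>] by auto
  then show ?case
    using Neg.IH[of A] Neg.prems v[of \<phi>] v[of "Neg \<phi>"] by simp
next
  case (And \<phi> \<psi>)
  obtain v where v: "\<And>\<sigma>. \<sigma> \<in> \<Sigma> \<Longrightarrow> holds v \<sigma> \<longleftrightarrow> \<sigma> \<in> A"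
    using world_holds[OF And.prems(2)] by blast
  have "\<phi> \<in> \<Sigma>" "\<psi> \<in> \<Sigma>" "And \<phi> \<psi> \<in> \<Sigma>"
    using And.prems self_in_cl[of \<phi>] self_in_cl[of \<psi>] by auto
  then show ?case
    using And.IH(1)[of A] And.IH(2)[of A] And.prems v[of \<phi>] v[of \<psi>] v[of "And \<phi> \<psi>"] by simp
next
  case (Or \<phi> \<psi>)
  obtain v where v: "\<And>\<sigma>. \<sigma> \<in> \<Sigma> \<Longrightarrow> holds v \<sigma> \<longleftrightarrow> \<sigma> \<in> A"
    using world_holds[OF Or.prems(2)] by blast
  have "\<phi> \<in> \<Sigma>" "\<psi> \<in> \<Sigma>" "Or \<phi> \<psi> \<in> \<Sigma>"
    using Or.prems self_in_cl[of \<phi>] self_in_cl[of \<psi>] by auto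
  then show ?case
    using Or.IH(1)[of A] Or.IH(2)[of A] Or.prems v[of \<phi>] v[of \<psi>] v[of "Or \<phi> \<psi>"] by simp
next
  case (Imp \<phi> \<psi>)
  obtain v where v: "\<And>\<sigma>. \<sigma> \<in> \<Sigma> \<Longrightarrow> holds v \<sigma> \<longleftrightarrow> \<sigma> \<in> A"
    using world_holds[OF Imp.prems(2)] by blast
  have "\<phi> \<in> \<Sigma>" "\<psi> \<in> \<Sigma>" "Imp \<phi> \<psi> \<in> \<Sigma>"
    using Imp.prems self_in_cl[of \<phi>] self_in_cl[of \<psi>] by auto
  then show ?case
    using Imp.IH(1)[of A] Imp.IH(2)[of A] Imp.prems v[of \<phi>] v[of \<psi>] v[of "Imp \<phi> \<psi>"] by simp
next
  case (Iff \<phi> \<psi>)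
  obtain v where v: "\<And>\<sigma>. \<sigma> \<in> \<Sigma> \<Longrightarrow> holds v \<sigma> \<longleftrightarrow> \<sigma> \<in> A"
    using world_holds[OF Iff.prems(2)] by blast
  have "\<phi> \<in> \<Sigma>" "\<psi> \<in> \<Sigma>" "Iff \<phi> \<psi> \<in> \<Sigma>"
    using Iff.prems self_in_cl[of \<phi>] self_in_cl[of \<psi>] by auto
  then show ?case
    using Iff.IH(1)[of A] Iff.IH(2)[of A] Iff.prems v[of \<phi>] v[of \<psi>] v[of "Iff \<phi> \<psi>"] by simp
qed (use world_holds[of tr \<Sigma>] in fastforce)+

text \<open>Frames over the single type \<open>fm set\<close> suffice, since the worlds of the
  countermodel are sets of formulas. \<open>soundness\<close> is available for every
  carrier.\<close>

lemma completeness: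
  assumes "\<And>(R :: (fm set \<times> fm set) set) V w. frame tr R \<Longrightarrow> sat R V w \<phi>"
  shows "\<phi> \<in> logic tr"
proof (rule ccontr)
  note L = normal_logic_logic[of tr]
  assume "\<phi> \<notin> logic tr"
  then have "consistent (logic tr) [Neg \<phi>]"
    using tautological_consequence[OF L, of "[Neg (big_and [Neg \<phi>])]" \<phi>]
    by (auto simp: consistent_def)
  then obtain A where "world (logic tr) (cl \<phi>) A" "\<phi> \<notin> A"
    using world_extend[OF L finite_cl[of \<phi>]] self_in_cl[of \<phi>] by (metis list.set_intros(1))
  then have "\<not> sat (canon tr (cl \<phi>)) (\<lambda>x. {A. Var x \<in> A}) A \<phi>"
    using canon_truth[of "cl \<phi>" \<phi> tr A] by simp
  then show False
    using assms[OF frame_canon[OF finite_cl[of \<phi>]]] by simp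
qed

section \<open>Bounded morphisms, unravelling and chains\<close>

primrec depth :: "fm \<Rightarrow> nat" where
  "depth (Var x) = 0"
| "depth Bot = 0"
| "depth Top = 0"
| "depth (Neg \<phi>) = depth \<phi>"
| "depth (And \<phi> \<psi>) = max (depth \<phi>) (depth \<psi>)"
| "depth (Or \<phi> \<psi>) = max (depth \<phi>) (depth \<psi>)"
| "depth (Imp \<phi> \<psi>) = max (depth \<phi>) (depth \<psi>)"
| "depth (Iff \<phi> \<psi>) = max (depth \<phi>) (depth \<psi>)"
| "depth (Box \<phi>) = Suc (depth \<phi>)"
| "depth (Dia \<phi>) = Suc (depth \<phi>)"

text \<open>\<open>G a n\<close> means that \<open>a\<close> may still be followed for
  \<open>n\<close> steps. With \<open>G\<close> constant in \<open>n\<close> this is the usual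
  bounded morphism; the graded form also covers unravellings that are cut off.\<close>

lemma bounded_morphism:
  assumes atoms: "\<And>a n x. G a n \<Longrightarrow> a \<in> V x \<longleftrightarrow> f a \<in> U x"
    and zig: "\<And>a b n. G a (Suc n) \<Longrightarrow> (a, b) \<in> R \<Longrightarrow> (f a, f b) \<in> S \<and> G b n"
    and zag: "\<And>a y n. G a (Suc n) \<Longrightarrow> (f a, y) \<in> S \<Longrightarrow> \<exists>b. (a, b) \<in> R \<and> f b = y"
  shows "depth \<phi> \<le> n \<Longrightarrow> G a n \<Longrightarrow> sat R V a \<phi> \<longleftrightarrow> sat S U (f a) \<phi>"
proof (induction \<phi> arbitrary: a n)
  case (Var x)
  then show ?case using atoms by simp
next
  case (Box \<phi>)
  then obtain m where m: "n = Suc m" "depth \<phi> \<le> m" by (cases n) auto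
  with Box.prems have a: "G a (Suc m)" by simp
  have "sat R V b \<phi> \<longleftrightarrow> sat S U (f b) \<phi>" "(f a, f b) \<in> S" if "(a, b) \<in> R" for b
    using Box.IH[OF m(2)] zig[OF a that] by auto
  then show ?case using zag[OF a] by fastforce
next
  case (Dia \<phi>)
  then obtain m where m: "n = Suc m" "depth \<phi> \<le> m" by (cases n) auto
  with Dia.prems have a: "G a (Suc m)" by simp
  have "sat R V b \<phi> \<longleftrightarrow> sat S U (f b) \<phi>" "(f a, f b) \<in> S" if "(a, b) \<in> R" for b
    using Dia.IH[OF m(2)] zig[OF a that] by auto
  then show ?case using zag[OF a] by fastforce
qed auto

section \<open>Chains and the chain model\<close>

abbreviation is_chain :: "('w \<times> 'w) set \<Rightarrow> 'w list \<Rightarrow> bool" where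
  "is_chain R \<equiv> successively (\<lambda>x y. (x, y) \<in> R)"

definition index_step :: "bool \<Rightarrow> nat \<Rightarrow> nat \<Rightarrow> bool" where
  "index_step tr i j \<longleftrightarrow> (if tr then i < j else j = Suc i)"

lemma chain_step:
  assumes "frame tr R" "is_chain R ws" "j < length ws" "index_step tr i j"
  shows "(ws ! i, ws ! j) \<in> R"
proof (cases tr)
  case True
  then have "transp (\<lambda>x y. (x, y) \<in> R)"
    using assms(1) by (auto simp: frame_def transp_def dest: transD)
  then have "sorted_wrt (\<lambda>x y. (x, y) \<in> R) ws"
    using assms(2) by (simp add: successively_conv_sorted_wrt)
  then show ?thesis
    using assms(3,4) True by (auto simp: index_step_def sorted_wrt_iff_nth_less)
next
  case False
  then show ?thesis
    using assms(2-4) by (auto simp: index_step_def successively_conv_nth)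
qed

lemma chain_append_last:
  assumes "frame tr R" "is_chain R (xs @ ys)" "xs \<noteq> []" "ys \<noteq> []" "tr \<or> length ys = 1"
  shows "(last xs, last ys) \<in> R"
proof -
  have "((xs @ ys) ! (length xs - 1), (xs @ ys) ! (length xs + length ys - 1)) \<in> R"
    using assms by (intro chain_step) (auto simp: index_step_def neq_Nil_conv)
  moreover have "(xs @ ys) ! (length xs + length ys - 1) = last ys"
    using assms(4) last_conv_nth[of "xs @ ys"] by simp
  ultimately show ?thesis
    using assms(3) by (simp add: nth_append last_conv_nth)
qed

lemma chain_set: "is_chain R ws \<Longrightarrow> set ws \<subseteq> insert (hd ws) (Range R)"
  by (induction ws rule: induct_list012) auto

text \<open>Transitivity and irreflexivity forbid repetitions, and only the head can lie outside the
  range.\<close>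

lemma chain_length:
  assumes "frame True R" "is_chain R ws"
  shows "length ws \<le> Suc (card (Range R))"
proof -
  have "ws ! i \<noteq> ws ! j" if "i < j" "j < length ws" for i j
    using chain_step[OF assms that(2), of i] that assms(1)
    by (auto simp: index_step_def frame_def irrefl_def)
  then have "distinct ws"
    unfolding distinct_conv_nth by (metis nat_neq_iff)
  then have "length ws = card (set ws)" by (simp add: distinct_card)
  also have "\<dots> \<le> card (insert (hd ws) (Range R))"
    using chain_set[OF assms(2)] assms(1) by (intro card_mono) (auto simp: frame_def finite_Range)
  also have "\<dots> \<le> Suc (card (Range R))" by (rule card_insert_le_m1) auto
  finally show ?thesis .
qed

text \<open>The chain \<open>ws\<close> is added to \<open>R\<close> as a set of fresh points, the \<open>i\<close>-th of which also sees
  all \<open>R\<close>-successors of \<open>ws ! i\<close>.\<close>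

definition chain_rel :: "bool \<Rightarrow> ('w \<times> 'w) set \<Rightarrow> 'w list \<Rightarrow> ((nat + 'w) \<times> (nat + 'w)) set" where
  "chain_rel tr R ws =
     {(Inl i, Inl j) |i j. j < length ws \<and> index_step tr i j} \<union>
     {(Inl i, Inr x) |i x. i < length ws \<and> (ws ! i, x) \<in> R} \<union>
     {(Inr x, Inr y) |x y. (x, y) \<in> R}"

definition chain_map :: "'w list \<Rightarrow> nat + 'w \<Rightarrow> 'w" where
  "chain_map ws = case_sum ((!) ws) id"

definition chain_val :: "nat \<Rightarrow> (nat \<Rightarrow> 'w set) \<Rightarrow> 'w list \<Rightarrow> nat \<Rightarrow> (nat + 'w) set" where
  "chain_val p V ws = (\<lambda>x. {a. chain_map ws a \<in> V x})(p := {Inl (length ws - 1)})"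

lemma chain_map_simps [simp]: "chain_map ws (Inl i) = ws ! i" "chain_map ws (Inr x) = x"
  by (simp_all add: chain_map_def)

lemma chain_rel_iff [simp]:
  "(Inl i, Inl j) \<in> chain_rel tr R ws \<longleftrightarrow> j < length ws \<and> index_step tr i j"
  "(Inl i, Inr x) \<in> chain_rel tr R ws \<longleftrightarrow> i < length ws \<and> (ws ! i, x) \<in> R"
  "(Inr x, Inr y) \<in> chain_rel tr R ws \<longleftrightarrow> (x, y) \<in> R"
  "(Inr x, Inl i) \<notin> chain_rel tr R ws"
  by (auto simp: chain_rel_def)

lemma ex_sum: "(\<exists>a. P a) \<longleftrightarrow> (\<exists>x. P (Inl x)) \<or> (\<exists>y. P (Inr y))"
  by (metis sumE)

lemma all_sum: "(\<forall>a. P a) \<longleftrightarrow> (\<forall>x. P (Inl x)) \<and> (\<forall>y. P (Inr y))"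
  by (metis sumE)

lemma frame_chain_rel:
  assumes "frame tr R" "is_chain R ws"
  shows "frame tr (chain_rel tr R ws)"
  unfolding frame_def
proof (intro conjI impI)
  let ?A = "Inl ` {..<length ws} \<union> Inr ` Field R"
  have "chain_rel tr R ws \<subseteq> ?A \<times> ?A"
    by (auto simp: chain_rel_def index_step_def Field_def split: if_splits)
  moreover have "finite ?A"
    using assms(1) by (simp add: frame_def finite_Field)
  ultimately show "finite (chain_rel tr R ws)"
    by (meson finite_SigmaI finite_subset)
next
  assume tr
  then have R: "trans R" "irrefl R" using assms(1) by (auto simp: frame_def)
  show "irrefl (chain_rel tr R ws)"
    using R(2) \<open>tr\<close> by (auto simp: irrefl_def chain_rel_def index_step_def)
  show "trans (chain_rel tr R ws)"
  proof (rule transI)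
    fix a b c
    assume "(a, b) \<in> chain_rel tr R ws" "(b, c) \<in> chain_rel tr R ws"
    moreover have "(ws ! i, x) \<in> R" if "i < j" "j < length ws" "(ws ! j, x) \<in> R" for i j x
      using chain_step[OF assms that(2), of i] R(1) that \<open>tr\<close>
      by (auto simp: index_step_def dest: transD)
    ultimately show "(a, c) \<in> chain_rel tr R ws"
      using R(1) \<open>tr\<close> by (cases a; cases b; cases c) (auto simp: index_step_def dest: transD)
  qed
qed

text \<open>With \<open>p\<close> pulled back as well, \<open>chain_map\<close> is a bounded
  morphism. The forth condition is \<open>chain_step\<close>; the back condition can always use an
  \<open>Inr\<close> point, because a copy sees every successor of its original.\<close>

lemma sat_chain_map:
  assumes "frame tr R" "is_chain R ws" "i < length ws"
  shows "sat (chain_rel tr R ws) (\<lambda>x. {a. chain_map ws a \<in> V x}) (Inl i) \<phi> \<longleftrightarrow> sat R V (ws ! i) \<phi>"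
proof -
  have "sat (chain_rel tr R ws) (\<lambda>x. {a. chain_map ws a \<in> V x}) (Inl i) \<phi> \<longleftrightarrow>
    sat R V (chain_map ws (Inl i)) \<phi>"
  \<comment> \<open>\<open>G\<close> excludes the indices beyond the chain, which have no successors
    at all.\<close>
  proof (rule bounded_morphism[where n = "depth \<phi>" and
      G = "\<lambda>a n. a \<in> Inl ` {..<length ws} \<union> range Inr"])
    fix a b
    assume "a \<in> Inl ` {..<length ws} \<union> range Inr" "(a, b) \<in> chain_rel tr R ws"
    then show "(chain_map ws a, chain_map ws b) \<in> R \<and> b \<in> Inl ` {..<length ws} \<union> range Inr"
      using chain_step[OF assms(1,2)] by (cases a; cases b) auto
  next
    fix a y
    assume "a \<in> Inl ` {..<length ws} \<union> range Inr" "(chain_map ws a, y) \<in> R"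
    then show "\<exists>b. (a, b) \<in> chain_rel tr R ws \<and> chain_map ws b = y"
      by (intro exI[of _ "Inr y"]) auto
  qed (use assms(3) in auto)
  then show ?thesis by simp
qed

text \<open>\<open>Inr\<close> is a bounded morphism from the model with \<open>p\<close> made
  empty: the ambient copy is closed under successors and avoids the marked point.\<close>

lemma sat_chain_Inr:
  "sat (chain_rel tr R ws) (chain_val p V ws) (Inr x) \<phi> \<longleftrightarrow> sat R V x (subst1 p Bot \<phi>)"
proof -
  have "sat R (V(p := {})) x \<phi> \<longleftrightarrow> sat (chain_rel tr R ws) (chain_val p V ws) (Inr x) \<phi>"
  proof (rule bounded_morphism[where n = "depth \<phi>" and G = "\<lambda>a n. True"])
    fix a :: 'a and y :: "nat + 'a"
    assume "(Inr a, y) \<in> chain_rel tr R ws"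
    then show "\<exists>b. (a, b) \<in> R \<and> Inr b = y" by (cases y) auto
  qed (auto simp: chain_val_def)
  then show ?thesis by (simp add: sat_subst1)
qed

text \<open>The source of the reduction to types: the successors off the chain contribute only a
  \<open>p\<close>-free condition on \<open>ws ! i\<close>.\<close>

lemma sat_chain_Box:
  assumes "i < length ws"
  shows "sat (chain_rel tr R ws) (chain_val p V ws) (Inl i) (Box \<phi>) \<longleftrightarrow>
    (\<forall>j<length ws. index_step tr i j \<longrightarrow> sat (chain_rel tr R ws) (chain_val p V ws) (Inl j) \<phi>) \<and>
    sat R V (ws ! i) (subst1 p Bot (Box \<phi>))"
  using assms by (auto simp: all_sum sat_chain_Inr)

lemma sat_chain_Dia:
  assumes "i < length ws"
  shows "sat (chain_rel tr R ws) (chain_val p V ws) (Inl i) (Dia \<phi>) \<longleftrightarrow>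
    (\<exists>j<length ws. index_step tr i j \<and> sat (chain_rel tr R ws) (chain_val p V ws) (Inl j) \<phi>) \<or>
    sat R V (ws ! i) (subst1 p Bot (Dia \<phi>))"
  using assms by (auto simp: ex_sum sat_chain_Inr)

section \<open>Unravelling with a cut-off\<close>

definition unravel_worlds :: "('w \<times> 'w) set \<Rightarrow> 'w \<Rightarrow> nat \<Rightarrow> ('w \<times> bool) list set" where
  "unravel_worlds R w N =
     {t. t \<noteq> [] \<and> hd t = (w, True) \<and> length t \<le> N \<and> is_chain R (map fst t)}"

text \<open>The Boolean tags duplicate every node, so that a chain of the unravelling never
  exhausts the successors of its points having a given label.\<close>

definition unravel :: "bool \<Rightarrow> ('w \<times> 'w) set \<Rightarrow> 'w \<Rightarrow> nat \<Rightarrow>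
    (('w \<times> bool) list \<times> ('w \<times> bool) list) set" where
  "unravel tr R w N = {(t, t @ ys) |t ys. t \<in> unravel_worlds R w N \<and>
     t @ ys \<in> unravel_worlds R w N \<and> ys \<noteq> [] \<and> (tr \<or> length ys = 1)}"

text \<open>The cut-off \<open>N\<close> exists for this: a frame for K may have cycles and
  infinitely many paths, while \<open>frame\<close> and \<open>additive_singleton\<close> ask for
  finiteness.\<close>

lemma finite_unravel_worlds:
  assumes "finite R"
  shows "finite (unravel_worlds R w N)"
proof (rule finite_subset)
  let ?A = "insert w (Range R) \<times> (UNIV :: bool set)"
  show "unravel_worlds R w N \<subseteq> {t. set t \<subseteq> ?A \<and> length t \<le> N}"
  proof
    fix t assume t: "t \<in> unravel_worlds R w N"
    then have "fst ` set t \<subseteq> insert w (Range R)"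
      using chain_set[of R "map fst t"] by (auto simp: unravel_worlds_def hd_map)
    then have "set t \<subseteq> ?A" by (simp add: subset_iff mem_Times_iff image_subset_iff)
    then show "t \<in> {t. set t \<subseteq> ?A \<and> length t \<le> N}"
      using t by (simp add: unravel_worlds_def)
  qed
  show "finite {t. set t \<subseteq> ?A \<and> length t \<le> N}"
    using assms by (intro finite_lists_length_le) (simp add: finite_Range)
qed

lemma frame_unravel:
  assumes "finite R"
  shows "frame tr (unravel tr R w N)"
  unfolding frame_def
proof (intro conjI impI)
  have "unravel tr R w N \<subseteq> unravel_worlds R w N \<times> unravel_worlds R w N"
    by (auto simp: unravel_def)
  then show "finite (unravel tr R w N)"
    using finite_unravel_worlds[OF assms] by (meson finite_SigmaI finite_subset)
  show "irrefl (unravel tr R w N)"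
    by (auto simp: irrefl_def unravel_def)
  assume tr
  then show "trans (unravel tr R w N)"
    by (auto simp: trans_def unravel_def)
qed

lemma unravel_step:
  assumes "frame tr R" "(t, u) \<in> unravel tr R w N"
  shows "(fst (last t), fst (last u)) \<in> R"
proof -
  obtain ys where ys: "u = t @ ys" "t \<noteq> []" "ys \<noteq> []" "tr \<or> length ys = 1"
      "is_chain R (map fst t @ map fst ys)"
    using assms(2) by (auto simp: unravel_def unravel_worlds_def)
  then have "(last (map fst t), last (map fst ys)) \<in> R"
    using assms(1) by (intro chain_append_last) auto
  then show ?thesis using ys by (simp add: last_map)
qed

lemma unravel_extend:
  assumes "t \<in> unravel_worlds R w N" "length t < N" "(fst (last t), x) \<in> R"
  shows "(t, t @ [(x, b)]) \<in> unravel tr R w N"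
  using assms by (auto simp: unravel_def unravel_worlds_def successively_append_iff last_map)

text \<open>In the intransitive case truth of formulas is only preserved up to the cut-off \<open>N\<close>.\<close>

definition within :: "bool \<Rightarrow> ('w \<times> 'w) set \<Rightarrow> 'w \<Rightarrow> nat \<Rightarrow> ('w \<times> bool) list \<Rightarrow> nat \<Rightarrow> bool" where
  "within tr R w N t n \<longleftrightarrow> t \<in> unravel_worlds R w N \<and> (tr \<or> length t + n \<le> N)"

lemma within_step:
  assumes "within tr R w N t (Suc n)" "(t, u) \<in> unravel tr R w N"
  shows "within tr R w N u n"
  using assms by (auto simp: within_def unravel_def)

text \<open>The cut-off never removes a successor that is needed: in GL the path extended by
  \<open>x\<close> still obeys \<open>chain_length\<close>, and in K \<open>within\<close> has
  reserved a step.\<close>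

lemma within_less:
  assumes "frame tr R" and N: "tr \<Longrightarrow> Suc (card (Range R)) \<le> N"
    and t: "within tr R w N t (Suc n)" and "(fst (last t), x) \<in> R"
  shows "length t < N"
proof (cases tr)
  case True
  have "is_chain R (map fst t @ [x])"
    using t assms(4) by (auto simp: within_def unravel_worlds_def successively_append_iff last_map)
  then show ?thesis
    using chain_length[of R "map fst t @ [x]"] assms(1) N True by simp
next
  case False
  then show ?thesis using t by (simp add: within_def)
qed

lemma sat_unravel:
  assumes R: "frame tr R" and N: "tr \<Longrightarrow> Suc (card (Range R)) \<le> N"
    and t: "within tr R w N t (depth \<phi>)"
  shows "sat (unravel tr R w N) (\<lambda>x. {t \<in> unravel_worlds R w N. fst (last t) \<in> V x}) t \<phi> \<longleftrightarrow>
    sat R V (fst (last t)) \<phi>"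
proof (rule bounded_morphism[where G = "within tr R w N" and n = "depth \<phi>" and f = "\<lambda>t. fst (last t)"])
  show "(fst (last t), fst (last u)) \<in> R \<and> within tr R w N u n"
    if "within tr R w N t (Suc n)" "(t, u) \<in> unravel tr R w N" for t u n
    using unravel_step[OF R that(2)] within_step[OF that] by (rule conjI)
  show "\<exists>u. (t, u) \<in> unravel tr R w N \<and> fst (last u) = y"
    if "within tr R w N t (Suc n)" "(fst (last t), y) \<in> R" for t n y
    using that unravel_extend[of t R w N y True tr] within_less[OF R N that]
    by (intro exI[of _ "t @ [(y, True)]"]) (auto simp: within_def)
qed (use t in \<open>auto simp: within_def\<close>)

text \<open>The map \<open>?f\<close> sends the prefixes of \<open>s\<close> to their chain
  positions and folds any other node to its last point. It respects the relation because an
  extension of a non-prefix is never a prefix, and it respects \<open>p\<close> because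
  \<open>s\<close> is the only prefix of full length.\<close>

lemma sat_unravel_chain:
  assumes R: "frame tr R" and N: "tr \<Longrightarrow> Suc (card (Range R)) \<le> N"
    and s: "s \<in> unravel_worlds R w N" and t: "within tr R w N [(w, True)] (depth \<phi>)"
  shows "sat (unravel tr R w N)
      ((\<lambda>x. {t \<in> unravel_worlds R w N. fst (last t) \<in> V x})(p := {s})) [(w, True)] \<phi> \<longleftrightarrow>
    sat (chain_rel tr R (map fst s)) (chain_val p V (map fst s)) (Inl 0) \<phi>"
proof -
  let ?f = "\<lambda>t. if take (length t) s = t then Inl (length t - 1) else Inr (fst (last t))"
  let ?T = "unravel tr R w N" and ?W = "unravel_worlds R w N"
  let ?C = "chain_rel tr R (map fst s)"
  have last: "map fst s ! (length t - 1) = fst (last t)" "length t \<le> length s"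
    if "t \<in> ?W" "take (length t) s = t" for t
  proof -
    have "t \<noteq> []" using that(1) by (simp add: unravel_worlds_def)
    have "length t = min (length s) (length t)" using that(2) by (metis length_take min.commute)
    then show le: "length t \<le> length s" by simp
    have "last t = t ! (length t - 1)" using \<open>t \<noteq> []\<close> by (rule last_conv_nth)
    also have "\<dots> = take (length t) s ! (length t - 1)" by (simp only: that(2))
    also have "\<dots> = s ! (length t - 1)" using \<open>t \<noteq> []\<close> by (intro nth_take) simp
    finally have "last t = s ! (length t - 1)" .
    moreover have "length t - 1 < length s" using le \<open>t \<noteq> []\<close> by (cases t) auto
    ultimately show "map fst s ! (length t - 1) = fst (last t)" by simp
  qed
  have "s \<noteq> []" "hd s = (w, True)" using s by (auto simp: unravel_worlds_def)
  then have s0: "take (length [(w, True)]) s = [(w, True)]" by (cases s) auto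
  have "sat ?T ((\<lambda>x. {t \<in> ?W. fst (last t) \<in> V x})(p := {s})) [(w, True)] \<phi> \<longleftrightarrow>
    sat ?C (chain_val p V (map fst s)) (?f [(w, True)]) \<phi>"
  proof (rule bounded_morphism[where G = "within tr R w N" and n = "depth \<phi>" and f = ?f])
    fix t n x
    assume "within tr R w N t n"
    then have tW: "t \<in> ?W" by (simp add: within_def)
    then have "t \<noteq> []" by (simp add: unravel_worlds_def)
    show "t \<in> ((\<lambda>x. {t \<in> ?W. fst (last t) \<in> V x})(p := {s})) x \<longleftrightarrow> ?f t \<in> chain_val p V (map fst s) x"
    proof (cases "take (length t) s = t")
      case True
      have "length t = length s \<Longrightarrow> t = s" using True by simp
      moreover have "length t - 1 = length s - 1 \<Longrightarrow> length t = length s"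
        using \<open>t \<noteq> []\<close> \<open>s \<noteq> []\<close> by (cases t; cases s) auto
      ultimately have "t = s \<longleftrightarrow> length t - 1 = length s - 1" by blast
      then show ?thesis
        using True last(1)[OF tW True] tW by (simp add: chain_val_def)
    next
      case False
      then have "t \<noteq> s" by auto
      then show ?thesis using False tW by (simp add: chain_val_def)
    qed
  next
    fix t u n
    assume t: "within tr R w N t (Suc n)" and tu: "(t, u) \<in> ?T"
    then obtain ys where ys: "u = t @ ys" "ys \<noteq> []" "tr \<or> length ys = 1"
      and W: "t \<in> ?W" "u \<in> ?W" by (auto simp: unravel_def)
    have tR: "(fst (last t), fst (last u)) \<in> R" using unravel_step[OF R tu] .
    have "t \<noteq> []" using W by (simp add: unravel_worlds_def)
    have "(?f t, ?f u) \<in> ?C"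
    proof (cases "take (length t) s = t")
      case t: True
      show ?thesis
      proof (cases "take (length u) s = u")
        case True
        have "length t < length u" using ys by simp
        moreover have "length u \<le> length s" using last(2)[OF W(2) True] .
        moreover have "length t > 0" using \<open>t \<noteq> []\<close> by simp
        moreover have "tr \<or> length u = Suc (length t)" using ys by auto
        ultimately have "length u - 1 < length (map fst s) \<and>
            index_step tr (length t - 1) (length u - 1)"
          by (cases t) (auto simp: index_step_def)
        then show ?thesis using t True by simp
      next
        case False
        moreover have "length t - 1 < length s"
          using last(2)[OF W(1) t] \<open>t \<noteq> []\<close> by (cases t) auto
        ultimately show ?thesis using t last(1)[OF W(1) t] tR by simp
      qed
    next
      case False
      have "take (length t) s = t" if "take (length u) s = u"
      proof -
        have "take (length t) (take (length u) s) = t" using that ys(1) by simp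
        then show ?thesis using ys(1) by (simp add: min_def)
      qed
      then show ?thesis using False tR by auto
    qed
    then show "(?f t, ?f u) \<in> ?C \<and> within tr R w N u n" using within_step[OF t tu] by blast
  next
    fix t y n
    assume t: "within tr R w N t (Suc n)" and ty: "(?f t, y) \<in> ?C"
    have W: "t \<in> ?W" using t by (simp add: within_def)
    then have "t \<noteq> []" by (simp add: unravel_worlds_def)
    show "\<exists>u. (t, u) \<in> ?T \<and> ?f u = y"
    proof (cases "take (length t) s = t")
      case True
      show ?thesis
      proof (cases y)
        case (Inl j)
        let ?u = "take (Suc j) s"
        have j: "j < length s" "index_step tr (length t - 1) j" using ty Inl True by auto
        then have "length t \<le> j" "tr \<or> j = length t"
          using \<open>t \<noteq> []\<close> by (auto simp: index_step_def Suc_leI split: if_splits)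
        then have u: "?u = t @ drop (length t) ?u" "drop (length t) ?u \<noteq> []"
          "tr \<or> length (drop (length t) ?u) = 1"
          using True j(1) append_take_drop_id[of "length t" ?u] by (auto simp: min_def)
        have "map fst s = map fst ?u @ map fst (drop (Suc j) s)"
          by (metis append_take_drop_id map_append)
        then have "is_chain R (map fst ?u)"
          using s by (simp only: unravel_worlds_def mem_Collect_eq successively_append_iff)
        then have "?u \<in> ?W"
          using s j(1) by (simp add: unravel_worlds_def hd_take)
        then have "(t, ?u) \<in> ?T" using W u unfolding unravel_def by fastforce
        then show ?thesis using Inl j(1) by (intro exI[of _ ?u]) (auto simp: min_def)
      next
        case (Inr x)
        then have "(map fst s ! (length t - 1), x) \<in> R" using ty True by (simp del: nth_map)
        then have tR: "(fst (last t), x) \<in> R" by (simp only: last(1)[OF W True])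
        \<comment> \<open>The flipped tag keeps the new node off \<open>s\<close> even if
          \<open>s\<close> itself continues with \<open>x\<close>. If \<open>s\<close> ends at
          \<open>t\<close>, the tag is arbitrary, but then \<open>?u\<close> is too long to be a
          prefix.\<close>
        let ?u = "t @ [(x, \<not> snd (s ! length t))]"
        have "take (length ?u) s \<noteq> ?u"
        proof
          assume eq: "take (length ?u) s = ?u"
          then have "length ?u = min (length s) (length ?u)" by (metis length_take min.commute)
          then have "length t < length s" by simp
          then have "s ! length t = take (length ?u) s ! length t" by (intro nth_take[symmetric]) simp
          also have "\<dots> = (x, \<not> snd (s ! length t))" unfolding eq by simp
          finally show False by (metis snd_conv)
        qed
        then show ?thesis
          using unravel_extend[OF W within_less[OF R N t tR] tR] Inr
          by (intro exI[of _ ?u]) simp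
      qed
    next
      case False
      then obtain x where x: "y = Inr x" "(fst (last t), x) \<in> R" using ty by (cases y) auto
      have "take (length t) s = t" if "take (length (t @ [(x, True)])) s = t @ [(x, True)]"
      proof -
        have "take (length t) (take (length (t @ [(x, True)])) s) = t" using that by simp
        then show ?thesis by (simp add: min_def)
      qed
      then show ?thesis
        using False x unravel_extend[OF W within_less[OF R N t x(2)] x(2)]
        by (intro exI[of _ "t @ [(x, True)]"]) auto
    qed
  qed (use t in auto)
  then show ?thesis using s0 by simp
qed

section \<open>Normal additive formulas\<close>

text \<open>Additivity read semantically: \<open>q\<close> names the set \<open>B\<close> and is
  then forgotten, as it does not occur in \<open>\<phi>\<close>.\<close>

lemma additive_union:
  assumes "normal_additive_in (logic tr) p q \<phi>" "p \<noteq> q" "q \<notin> vars \<phi>" "frame tr R"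
  shows "sat R (V(p := A \<union> B)) w \<phi> \<longleftrightarrow> sat R (V(p := A)) w \<phi> \<or> sat R (V(p := B)) w \<phi>"
proof -
  let ?V = "V(p := A, q := B)"
  have "sat R ?V w (Iff (subst1 p (Or (Var p) (Var q)) \<phi>) (Or \<phi> (subst1 p (Var q) \<phi>)))"
    using assms(1) unfolding normal_additive_in_def additive_in_def
    by (intro soundness[OF assms(4)]) blast
  then have "sat R (?V(p := A \<union> B)) w \<phi> \<longleftrightarrow> sat R ?V w \<phi> \<or> sat R (?V(p := B)) w \<phi>"
    using assms(2) by (simp add: sat_subst1 Collect_disj_eq)
  moreover have "?V(p := A \<union> B) = (V(p := A \<union> B))(q := B)" "?V(p := B) = (V(p := B))(q := B)"
    using assms(2) by (auto simp: fun_eq_iff)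
  moreover have "sat R (U(q := B)) w \<phi> \<longleftrightarrow> sat R U w \<phi>" for U
    using assms(3) by (intro sat_cong_vars) auto
  ultimately show ?thesis by (simp only:)
qed

lemma additive_mono:
  assumes "normal_additive_in (logic tr) p q \<phi>" "p \<noteq> q" "q \<notin> vars \<phi>" "frame tr R"
    and "A \<subseteq> B" "sat R (V(p := A)) w \<phi>"
  shows "sat R (V(p := B)) w \<phi>"
  using additive_union[OF assms(1-4), of V A B w] assms(5,6) by (simp add: Un_absorb1)

lemma additive_singleton:
  assumes "normal_additive_in (logic tr) p q \<phi>" "p \<noteq> q" "q \<notin> vars \<phi>" "frame tr R"
    and "finite A" "sat R (V(p := A)) w \<phi>"
  shows "\<exists>s\<in>A. sat R (V(p := {s})) w \<phi>"
  using assms(5,6)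
proof (induction A rule: finite_induct)
  case empty
  have "sat R V w (Iff (subst1 p Bot \<phi>) Bot)"
    using assms(1) unfolding normal_additive_in_def normal_in_def
    by (intro soundness[OF assms(4)]) blast
  then show ?case using empty by (simp add: sat_subst1)
next
  case (insert s A)
  then have "sat R (V(p := {s} \<union> A)) w \<phi>" by (simp add: fun_upd_def)
  then show ?case
    using additive_union[OF assms(1-4), of V "{s}" A w] insert.IH by blast
qed

lemma chain_exists:
  assumes \<phi>: "normal_additive_in (logic tr) p q \<phi>" "p \<noteq> q" "q \<notin> vars \<phi>"
    and R: "frame tr R" and sat: "sat R V w \<phi>"
  obtains ws where "ws \<noteq> []" "hd ws = w" "is_chain R ws" "last ws \<in> V p"
    "\<not> tr \<Longrightarrow> length ws \<le> Suc (depth \<phi>)"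
    "sat (chain_rel tr R ws) (chain_val p V ws) (Inl 0) \<phi>"
proof -
  \<comment> \<open>In K the root needs \<open>depth \<phi>\<close> further steps, hence paths of
    one point more. In GL no chain exceeds this \<open>N\<close>, so nothing is cut off.\<close>
  define N where "N = (if tr then Suc (card (Range R)) else Suc (depth \<phi>))"
  let ?V = "\<lambda>x. {t \<in> unravel_worlds R w N. fst (last t) \<in> V x}"
  have N: "tr \<Longrightarrow> Suc (card (Range R)) \<le> N" by (simp add: N_def)
  have root: "within tr R w N [(w, True)] (depth \<phi>)"
    by (simp add: within_def N_def unravel_worlds_def)
  have fin: "finite R" using R by (simp add: frame_def)
  have "sat (unravel tr R w N) ?V [(w, True)] \<phi>"
    using sat_unravel[OF R N root, of V] sat by simp
  then have "sat (unravel tr R w N) (?V(p := ?V p)) [(w, True)] \<phi>"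
    by (simp add: fun_upd_idem)
  then obtain s where s: "s \<in> ?V p" "sat (unravel tr R w N) (?V(p := {s})) [(w, True)] \<phi>"
    using additive_singleton[OF \<phi> frame_unravel[OF fin]] finite_unravel_worlds[OF fin]
    by (metis (no_types, lifting) finite_Collect_conjI mem_Collect_eq finite_subset subsetI)
  have sW: "s \<in> unravel_worlds R w N" using s(1) by simp
  show thesis
  proof (rule that[of "map fst s"])
    show "sat (chain_rel tr R (map fst s)) (chain_val p V (map fst s)) (Inl 0) \<phi>"
      using sat_unravel_chain[OF R N sW root] s(2) by blast
  qed (use s(1) in \<open>auto simp: unravel_worlds_def N_def hd_map last_map\<close>)
qed

section \<open>Bounding the length of chains\<close>

text \<open>A transitive chain may be thinned out to the positions \<open>js\<close> as long as the last
  witness of every relevant formula is kept.\<close>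

lemma chain_select:
  fixes R :: "('w \<times> 'w) set" and p :: nat and V :: "nat \<Rightarrow> 'w set"
  defines "C \<equiv> \<lambda>ws i. sat (chain_rel True R ws) (chain_val p V ws) (Inl i)"
  assumes js: "sorted_wrt (<) js" "set js \<subseteq> {..<length ws}" "length ws - 1 \<in> set js"
    and wit: "\<And>\<chi> j. \<chi> \<in> \<Sigma> \<union> Neg ` \<Sigma> \<Longrightarrow> j < length ws \<Longrightarrow> C ws j \<chi> \<Longrightarrow>
      \<exists>j'\<in>set js. j \<le> j' \<and> C ws j' \<chi>"
  shows "cl \<psi> \<subseteq> \<Sigma> \<Longrightarrow> m < length js \<Longrightarrow> C (map ((!) ws) js) m \<psi> \<longleftrightarrow> C ws (js ! m) \<psi>"
proof -
  have lt: "js ! i < js ! j" if "i < j" "j < length js" for i j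
    using js(1) that by (simp add: sorted_wrt_iff_nth_less)
  have bound: "js ! i < length ws" if "i < length js" for i
    using js(2) that nth_mem by blast
  \<comment> \<open>Moving a witness to a later position keeps it visible from
    \<open>js ! m\<close>, so only selected witnesses matter. The successors off the chain are the
    same before and after thinning.\<close>
  have steps: "(\<exists>j<length ws. js ! m < j \<and> C ws j \<chi>) \<longleftrightarrow>
    (\<exists>m'<length js. m < m' \<and> C ws (js ! m') \<chi>)"
    if m: "m < length js" and \<chi>: "\<chi> \<in> \<Sigma> \<union> Neg ` \<Sigma>" for m \<chi>
  proof
    assume "\<exists>j<length ws. js ! m < j \<and> C ws j \<chi>"
    then obtain j where j: "j < length ws" "js ! m < j" "C ws j \<chi>" by blast
    from wit[OF \<chi> j(1,3)] obtain m' where m': "m' < length js" "j \<le> js ! m'" "C ws (js ! m') \<chi>"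
      by (auto simp: in_set_conv_nth)
    then have "js ! m < js ! m'" using j(2) by simp
    then have "m < m'" using lt[of m' m] m by (metis less_asym linorder_neqE_nat less_irrefl)
    then show "\<exists>m'<length js. m < m' \<and> C ws (js ! m') \<chi>" using m' by blast
  next
    assume "\<exists>m'<length js. m < m' \<and> C ws (js ! m') \<chi>"
    then show "\<exists>j<length ws. js ! m < j \<and> C ws j \<chi>" using lt bound by blast
  qed
  show "cl \<psi> \<subseteq> \<Sigma> \<Longrightarrow> m < length js \<Longrightarrow> C (map ((!) ws) js) m \<psi> \<longleftrightarrow> C ws (js ! m) \<psi>"
  proof (induction \<psi> arbitrary: m)
    case (Var x)
    \<comment> \<open>\<open>p\<close> marks the end of the chain, so the end must be selected, and
      it must be the last selected position.\<close>
    obtain k where k: "k < length js" "js ! k = length ws - 1"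
      using js(3) by (auto simp: in_set_conv_nth)
    have "\<not> k < length js - 1"
    proof
      assume less: "k < length js - 1"
      then have "length js - 1 < length js" by simp
      from lt[OF less this] bound[OF this] k(2) show False by simp
    qed
    then have "k = length js - 1" using k(1) by simp
    then have "m = length js - 1 \<longleftrightarrow> js ! m = length ws - 1"
      using k lt Var.prems(2) by (metis less_irrefl linorder_neqE_nat)
    then show ?case using Var.prems by (simp add: C_def chain_val_def)
  next
    case (Box \<psi>)
    \<comment> \<open>A box fails through a witness of the negated formula; for this reason
      \<open>wit\<close> also covers the negations of formulas in \<open>\<Sigma>\<close>.\<close>
    have \<psi>: "Neg \<psi> \<in> \<Sigma> \<union> Neg ` \<Sigma>" "cl \<psi> \<subseteq> \<Sigma>"
      using Box.prems(1) self_in_cl[of \<psi>] by (auto simp del: self_in_cl)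
    have neg: "C us i (Neg \<psi>) \<longleftrightarrow> \<not> C us i \<psi>" for us i by (simp add: C_def)
    have "(\<forall>j<length ws. js ! m < j \<longrightarrow> C ws j \<psi>) \<longleftrightarrow> (\<forall>m'<length js. m < m' \<longrightarrow> C ws (js ! m') \<psi>)"
      using steps[OF Box.prems(2) \<psi>(1)] unfolding neg by blast
    also have "\<dots> \<longleftrightarrow> (\<forall>m'<length js. m < m' \<longrightarrow> C (map ((!) ws) js) m' \<psi>)"
      using Box.IH[OF \<psi>(2)] by blast
    finally show ?case
      using sat_chain_Box[of m "map ((!) ws) js" True R p V \<psi>] Box.prems(2)
        sat_chain_Box[of "js ! m" ws True R p V \<psi>] bound[OF Box.prems(2)]
      unfolding C_def index_step_def by simp
  next
    case (Dia \<psi>)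
    have \<psi>: "\<psi> \<in> \<Sigma> \<union> Neg ` \<Sigma>" "cl \<psi> \<subseteq> \<Sigma>" using Dia.prems(1) self_in_cl[of \<psi>] by auto
    have "(\<exists>j<length ws. js ! m < j \<and> C ws j \<psi>) \<longleftrightarrow> (\<exists>m'<length js. m < m' \<and> C ws (js ! m') \<psi>)"
      by (rule steps[OF Dia.prems(2) \<psi>(1)])
    also have "\<dots> \<longleftrightarrow> (\<exists>m'<length js. m < m' \<and> C (map ((!) ws) js) m' \<psi>)"
      using Dia.IH[OF \<psi>(2)] by blast
    finally show ?case
      using sat_chain_Dia[of m "map ((!) ws) js" True R p V \<psi>] Dia.prems(2)
        sat_chain_Dia[of "js ! m" ws True R p V \<psi>] bound[OF Dia.prems(2)]
      unfolding C_def index_step_def by simp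
  qed (simp_all add: C_def)
qed

lemma chain_shorten:
  fixes p :: nat and V :: "nat \<Rightarrow> 'w set"
  assumes R: "frame True R" "is_chain R ws" and "ws \<noteq> []"
    and sat: "sat (chain_rel True R ws) (chain_val p V ws) (Inl 0) \<phi>"
  obtains us where "us \<noteq> []" "hd us = hd ws" "last us = last ws" "is_chain R us"
    "length us \<le> 2 + card (cl \<phi> \<union> Neg ` cl \<phi>)"
    "sat (chain_rel True R us) (chain_val p V us) (Inl 0) \<phi>"
proof -
  let ?C = "\<lambda>j. sat (chain_rel True R ws) (chain_val p V ws) (Inl j)"
  let ?X = "cl \<phi> \<union> Neg ` cl \<phi>"
  let ?W = "\<lambda>\<chi>. {j. j < length ws \<and> ?C j \<chi>}"
  \<comment> \<open>Position 0 evaluates \<open>\<phi>\<close> and the last one carries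
    \<open>p\<close>, which gives the summand 2 of the bound. One further position per formula is
    enough, as its greatest witness serves all earlier positions at once.\<close>
  define J where "J = {0, length ws - 1} \<union> (\<lambda>\<chi>. Max (?W \<chi>)) ` {\<chi> \<in> ?X. ?W \<chi> \<noteq> {}}"
  define js where "js = sorted_list_of_set J"
  have "finite {\<chi> \<in> ?X. ?W \<chi> \<noteq> {}}" by simp
  then have "finite J" by (simp add: J_def)
  have Max: "Max (?W \<chi>) \<in> ?W \<chi>" if "?W \<chi> \<noteq> {}" for \<chi> by (rule Max_in) (use that in auto)
  have "card J \<le> card {0, length ws - 1} + card ((\<lambda>\<chi>. Max (?W \<chi>)) ` {\<chi> \<in> ?X. ?W \<chi> \<noteq> {}})"
    unfolding J_def by (rule card_Un_le)
  also have "\<dots> \<le> 2 + card ?X"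
  proof (rule add_mono)
    show "card {0, length ws - 1} \<le> 2" by (simp add: card_insert_if)
    have "card ((\<lambda>\<chi>. Max (?W \<chi>)) ` {\<chi> \<in> ?X. ?W \<chi> \<noteq> {}}) \<le> card {\<chi> \<in> ?X. ?W \<chi> \<noteq> {}}"
      by (rule card_image_le) simp
    also have "\<dots> \<le> card ?X" by (rule card_mono) auto
    finally show "card ((\<lambda>\<chi>. Max (?W \<chi>)) ` {\<chi> \<in> ?X. ?W \<chi> \<noteq> {}}) \<le> card ?X" .
  qed
  finally have len: "length js \<le> 2 + card ?X" by (simp add: js_def)
  have set: "set js = J" using \<open>finite J\<close> by (simp add: js_def)
  have sorted: "sorted_wrt (<) js" by (simp add: js_def)
  have sub: "set js \<subseteq> {..<length ws}"
    unfolding set J_def Un_subset_iff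
  proof (intro conjI image_subsetI)
    fix \<chi> assume "\<chi> \<in> {\<chi> \<in> ?X. ?W \<chi> \<noteq> {}}"
    then have "Max (?W \<chi>) \<in> ?W \<chi>" by (intro Max) blast
    then show "Max (?W \<chi>) \<in> {..<length ws}" by (simp only: mem_Collect_eq lessThan_iff)
  qed (use \<open>ws \<noteq> []\<close> in simp)
  have ends: "0 \<in> set js" "length ws - 1 \<in> set js" by (auto simp: set J_def)
  have wit: "\<exists>j'\<in>set js. j \<le> j' \<and> ?C j' \<chi>" if "\<chi> \<in> ?X" "j < length ws" "?C j \<chi>" for \<chi> j
  proof
    have ne: "?W \<chi> \<noteq> {}" using that by blast
    show "Max (?W \<chi>) \<in> set js" using that(1) ne unfolding set J_def by blast
    show "j \<le> Max (?W \<chi>) \<and> ?C (Max (?W \<chi>)) \<chi>" using Max[OF ne] that by (auto intro: Max_ge)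
  qed
  have "js \<noteq> []" using ends by auto
  have lt: "js ! i < js ! j" if "i < j" "j < length js" for i j
    using sorted that by (simp add: sorted_wrt_iff_nth_less)
  have bound: "js ! i < length ws" if "i < length js" for i
    using sub that nth_mem by blast
  have hd: "js ! 0 = 0"
  proof -
    obtain i where "i < length js" "js ! i = 0" using ends by (auto simp: in_set_conv_nth)
    then show ?thesis using lt[of 0 i] by (cases "i = 0") auto
  qed
  have last: "last js = length ws - 1"
  proof -
    obtain i where i: "i < length js" "js ! i = length ws - 1"
      using ends by (auto simp: in_set_conv_nth)
    have "\<not> i < length js - 1"
    proof
      assume less: "i < length js - 1"
      then have "length js - 1 < length js" by simp
      from lt[OF less this] bound[OF this] i(2) show False by simp
    qed
    then have "i = length js - 1" using i(1) by simp
    then show ?thesis using i \<open>js \<noteq> []\<close> by (simp add: last_conv_nth)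
  qed
  show thesis
  proof (rule that[of "map ((!) ws) js"])
    show "hd (map ((!) ws) js) = hd ws" "last (map ((!) ws) js) = last ws"
      using hd last \<open>js \<noteq> []\<close> \<open>ws \<noteq> []\<close> by (simp_all add: hd_map last_map hd_conv_nth last_conv_nth)
    show "is_chain R (map ((!) ws) js)"
      unfolding successively_conv_nth
      using chain_step[OF R] lt bound by (simp add: index_step_def)
    show "sat (chain_rel True R (map ((!) ws) js)) (chain_val p V (map ((!) ws) js)) (Inl 0) \<phi>"
      using chain_select[OF sorted sub ends(2) wit, where \<psi> = \<phi> and m = 0] hd sat \<open>js \<noteq> []\<close> by simp
  qed (use \<open>js \<noteq> []\<close> len in auto)
qed

text \<open>One number for both logics: the bound for K plus the bound for GL.\<close>

definition chain_bound :: "fm \<Rightarrow> nat" where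
  "chain_bound \<phi> = Suc (depth \<phi>) + (2 + card (cl \<phi> \<union> Neg ` cl \<phi>))"

lemma bounded_chain_exists:
  assumes \<phi>: "normal_additive_in (logic tr) p q \<phi>" "p \<noteq> q" "q \<notin> vars \<phi>"
    and R: "frame tr R" and sat: "sat R V w \<phi>"
  obtains ws where "ws \<noteq> []" "hd ws = w" "is_chain R ws" "last ws \<in> V p"
    "length ws \<le> chain_bound \<phi>"
    "sat (chain_rel tr R ws) (chain_val p V ws) (Inl 0) \<phi>"
proof -
  obtain ws where ws: "ws \<noteq> []" "hd ws = w" "is_chain R ws" "last ws \<in> V p"
    "\<not> tr \<Longrightarrow> length ws \<le> Suc (depth \<phi>)"
    "sat (chain_rel tr R ws) (chain_val p V ws) (Inl 0) \<phi>"
    using chain_exists[OF assms] by blast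
  show thesis
  proof (cases tr)
    case True
    obtain us where us: "us \<noteq> []" "hd us = hd ws" "last us = last ws" "is_chain R us"
      "length us \<le> 2 + card (cl \<phi> \<union> Neg ` cl \<phi>)"
      "sat (chain_rel tr R us) (chain_val p V us) (Inl 0) \<phi>"
      using chain_shorten[of R ws p V \<phi>] R ws True by auto
    then show thesis using that[of us] ws by (simp add: chain_bound_def)
  next
    case False
    then show thesis using that[of ws] ws by (simp add: chain_bound_def)
  qed
qed

text \<open>A modality splits into a chain part, settled by induction, and a \<open>p\<close>-free
  part, settled by the types. The truth of \<open>p\<close> itself depends only on the position and
  the common length.\<close>

lemma chain_transfer:
  assumes "length us = length ws"
    and types: "\<And>i \<psi>. i < length ws \<Longrightarrow> \<psi> \<in> \<Sigma> \<Longrightarrow>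
      sat R V (ws ! i) (subst1 p Bot \<psi>) \<longleftrightarrow> sat S U (us ! i) (subst1 p Bot \<psi>)"
  shows "cl \<psi> \<subseteq> \<Sigma> \<Longrightarrow> i < length ws \<Longrightarrow>
    sat (chain_rel tr R ws) (chain_val p V ws) (Inl i) \<psi> \<longleftrightarrow>
    sat (chain_rel tr S us) (chain_val p U us) (Inl i) \<psi>"
proof (induction \<psi> arbitrary: i)
  case (Var x)
  then show ?case
    using types[of i "Var x"] assms(1) by (cases "x = p") (simp_all add: chain_val_def)
next
  case (Box \<psi>)
  have "sat R V (ws ! i) (subst1 p Bot (Box \<psi>)) \<longleftrightarrow> sat S U (us ! i) (subst1 p Bot (Box \<psi>))"
    using Box.prems by (intro types) auto
  moreover have "cl \<psi> \<subseteq> \<Sigma>" using Box.prems(1) by simp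
  ultimately show ?case
    using Box.IH Box.prems(2) assms(1)
    unfolding sat_chain_Box[OF Box.prems(2)] sat_chain_Box[of i us, unfolded assms(1), OF Box.prems(2)]
    by blast
next
  case (Dia \<psi>)
  have "sat R V (ws ! i) (subst1 p Bot (Dia \<psi>)) \<longleftrightarrow> sat S U (us ! i) (subst1 p Bot (Dia \<psi>))"
    using Dia.prems by (intro types) auto
  moreover have "cl \<psi> \<subseteq> \<Sigma>" using Dia.prems(1) by simp
  ultimately show ?case
    using Dia.IH Dia.prems(2) assms(1)
    unfolding sat_chain_Dia[OF Dia.prems(2)] sat_chain_Dia[of i us, unfolded assms(1), OF Dia.prems(2)]
    by blast
qed simp_all

section \<open>Disjunctions of \<open>\<delta>\<close>-formulas\<close>

text \<open>\<open>list_all2\<close> against a nonempty list makes \<open>ws\<close> nonempty, so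
  \<open>hd\<close> and \<open>last\<close> are meaningful.\<close>

lemma sat_delta:
  "sat R V w (delta p \<kappa> \<kappa>s) \<longleftrightarrow>
    (\<exists>ws. hd ws = w \<and> is_chain R ws \<and> last ws \<in> V p \<and> list_all2 (sat R V) ws (\<kappa> # \<kappa>s))"
proof (induction \<kappa>s arbitrary: w \<kappa>)
  case Nil
  show ?case
  proof
    assume "sat R V w (delta p \<kappa> [])"
    then show "\<exists>ws. hd ws = w \<and> is_chain R ws \<and> last ws \<in> V p \<and> list_all2 (sat R V) ws [\<kappa>]"
      by (intro exI[of _ "[w]"]) auto
  qed (auto simp: list_all2_Cons2)
next
  case (Cons \<kappa>' \<kappa>s)
  show ?case
  proof
    assume "sat R V w (delta p \<kappa> (\<kappa>' # \<kappa>s))"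
    then obtain v where v: "sat R V w \<kappa>" "(w, v) \<in> R" "sat R V v (delta p \<kappa>' \<kappa>s)" by auto
    then obtain ws where "hd ws = v" "is_chain R ws" "last ws \<in> V p"
      "list_all2 (sat R V) ws (\<kappa>' # \<kappa>s)" using Cons.IH by blast
    then show "\<exists>ws. hd ws = w \<and> is_chain R ws \<and> last ws \<in> V p \<and>
        list_all2 (sat R V) ws (\<kappa> # \<kappa>' # \<kappa>s)"
      using v by (intro exI[of _ "w # ws"]) (auto simp: list_all2_Cons2)
  next
    assume "\<exists>ws. hd ws = w \<and> is_chain R ws \<and> last ws \<in> V p \<and>
        list_all2 (sat R V) ws (\<kappa> # \<kappa>' # \<kappa>s)"
    then obtain v ws where ws: "is_chain R (w # v # ws)" "last (v # ws) \<in> V p" "sat R V w \<kappa>"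
      "list_all2 (sat R V) (v # ws) (\<kappa>' # \<kappa>s)"
      by (auto simp: list_all2_Cons2)
    have "sat R V v (delta p \<kappa>' \<kappa>s)"
      unfolding Cons.IH using ws by (intro exI[of _ "v # ws"]) auto
    then show "sat R V w (delta p \<kappa> (\<kappa>' # \<kappa>s))" using ws by auto
  qed
qed

lemma sat_upd_not_vars: "p \<notin> vars \<phi> \<Longrightarrow> sat R (V(p := A)) w \<phi> \<longleftrightarrow> sat R V w \<phi>"
  by (rule sat_cong_vars) auto

text \<open>\<open>p\<close> occurs once, below diamonds and conjunctions with \<open>p\<close>-free
  formulas, and both commute with unions. Taking \<open>A\<close> empty will give normality, taking
  \<open>A\<close> a union will give additivity.\<close>

lemma sat_delta_pointwise:
  assumes "p \<notin> vars \<kappa>" "\<And>\<kappa>'. \<kappa>' \<in> set \<kappa>s \<Longrightarrow> p \<notin> vars \<kappa>'"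
  shows "sat R (V(p := A)) w (delta p \<kappa> \<kappa>s) \<longleftrightarrow> (\<exists>v\<in>A. sat R (V(p := {v})) w (delta p \<kappa> \<kappa>s))"
  using assms
proof (induction \<kappa>s arbitrary: w \<kappa>)
  case Nil
  then have "sat R (V(p := B)) w \<kappa> \<longleftrightarrow> sat R V w \<kappa>" for B by (simp add: sat_upd_not_vars)
  then show ?case unfolding delta.simps sat.simps fun_upd_same by blast
next
  case (Cons \<kappa>' \<kappa>s)
  have "sat R (V(p := A)) v (delta p \<kappa>' \<kappa>s) \<longleftrightarrow> (\<exists>x\<in>A. sat R (V(p := {x})) v (delta p \<kappa>' \<kappa>s))" for v
    using Cons.prems by (intro Cons.IH) auto
  moreover have "sat R (V(p := B)) w \<kappa> \<longleftrightarrow> sat R V w \<kappa>" for B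
    using Cons.prems(1) by (rule sat_upd_not_vars)
  ultimately show ?case unfolding delta.simps sat.simps by blast
qed

lemma delta_disjunction_normal_additive:
  assumes "p \<notin> X" and \<psi>s: "set \<psi>s \<subseteq> delta_formulas p X"
    and equiv: "equivalent_in (logic tr) \<phi> (big_or \<psi>s)"
  shows "normal_additive_in (logic tr) p q \<phi>"
proof -
  have pointwise: "sat R (V(p := A)) w \<phi> \<longleftrightarrow> (\<exists>v\<in>A. sat R (V(p := {v})) w \<phi>)"
    if R: "frame tr R" for R :: "(fm set \<times> fm set) set" and V A w
  proof -
    have \<phi>: "sat R U w \<phi> \<longleftrightarrow> (\<exists>\<psi>\<in>set \<psi>s. sat R U w \<psi>)" for U
    proof -
      have "sat R U w (Iff \<phi> (big_or \<psi>s))"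
        by (rule soundness[OF R]) (use equiv in \<open>simp add: equivalent_in_def\<close>)
      then show ?thesis by (simp add: sat_big_or)
    qed
    have "sat R (V(p := A)) w \<psi> \<longleftrightarrow> (\<exists>v\<in>A. sat R (V(p := {v})) w \<psi>)" if \<psi>: "\<psi> \<in> set \<psi>s" for \<psi>
    proof -
      obtain \<kappa> \<kappa>s where \<kappa>s: "\<psi> = delta p \<kappa> \<kappa>s" "\<kappa> \<in> Fm X" "set \<kappa>s \<subseteq> Fm X"
        using \<psi>s \<psi> unfolding delta_formulas_def by blast
      then have "p \<notin> vars \<kappa>" "\<And>\<kappa>'. \<kappa>' \<in> set \<kappa>s \<Longrightarrow> p \<notin> vars \<kappa>'"
        using assms(1) by (auto simp: Fm_def)
      then show ?thesis unfolding \<kappa>s(1) by (rule sat_delta_pointwise)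
    qed
    then show ?thesis unfolding \<phi> by blast
  qed
  have "normal_in (logic tr) p \<phi>"
    unfolding normal_in_def
  proof (rule completeness)
    fix R :: "(fm set \<times> fm set) set" and V w
    assume "frame tr R"
    then show "sat R V w (Iff (subst1 p Bot \<phi>) Bot)"
      using pointwise[of R V "{}" w] by (simp add: sat_subst1)
  qed
  moreover have "additive_in (logic tr) p q \<phi>"
    unfolding additive_in_def
  proof (rule completeness)
    fix R :: "(fm set \<times> fm set) set" and V w
    assume R: "frame tr R"
    have "sat R (V(p := V p \<union> V q)) w \<phi> \<longleftrightarrow> sat R (V(p := V p)) w \<phi> \<or> sat R (V(p := V q)) w \<phi>"
      unfolding pointwise[OF R, of V "V p \<union> V q" w] pointwise[OF R, of V "V p" w]
        pointwise[OF R, of V "V q" w] by (rule bex_Un)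
    then show "sat R V w (Iff (subst1 p (Or (Var p) (Var q)) \<phi>) (Or \<phi> (subst1 p (Var q) \<phi>)))"
      by (simp add: sat_subst1 Collect_disj_eq)
  qed
  ultimately show ?thesis by (simp add: normal_additive_in_def)
qed

section \<open>From normal additive formulas to disjunctions\<close>

definition type_formula :: "fm list \<Rightarrow> fm set \<Rightarrow> fm" where
  "type_formula \<sigma>s A = big_and (map (\<lambda>\<sigma>. if \<sigma> \<in> A then \<sigma> else Neg \<sigma>) \<sigma>s)"

lemma sat_type_formula:
  "sat R V w (type_formula \<sigma>s A) \<longleftrightarrow> (\<forall>\<sigma>\<in>set \<sigma>s. sat R V w \<sigma> \<longleftrightarrow> \<sigma> \<in> A)"
  by (induction \<sigma>s) (auto simp: type_formula_def)

lemma vars_type_formula: "vars (type_formula \<sigma>s A) = (\<Union>\<sigma>\<in>set \<sigma>s. vars \<sigma>)"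
  by (induction \<sigma>s) (auto simp: type_formula_def)

lemma vars_subst1_Bot: "vars (subst1 p Bot \<phi>) = vars \<phi> - {p}"
  by (induction \<phi>) auto

text \<open>A chain realising the \<open>\<delta>\<close>-formula carries the same truth values, and it maps back into
  the ambient model, where \<open>p\<close> is true at possibly more points.\<close>

lemma chain_delta_implies:
  fixes R :: "('w \<times> 'w) set"
  assumes \<phi>: "normal_additive_in (logic tr) p q \<phi>" "p \<noteq> q" "q \<notin> vars \<phi>"
    and \<sigma>s: "set \<sigma>s = subst1 p Bot ` cl \<phi>"
    and sat: "sat (chain_rel tr R (w # ws)) (chain_val p V (w # ws)) (Inl 0) \<phi>"
  defines "\<tau> \<equiv> \<lambda>x. type_formula \<sigma>s {\<sigma> \<in> set \<sigma>s. sat R V x \<sigma>}"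
  shows "Imp (delta p (\<tau> w) (map \<tau> ws)) \<phi> \<in> logic tr"
proof (rule completeness)
  fix S :: "(fm set \<times> fm set) set" and U u
  assume S: "frame tr S"
  show "sat S U u (Imp (delta p (\<tau> w) (map \<tau> ws)) \<phi>)"
    unfolding sat.simps(7)
  proof
    assume "sat S U u (delta p (\<tau> w) (map \<tau> ws))"
    then obtain us where us: "hd us = u" "is_chain S us" "last us \<in> U p"
      and types: "list_all2 (sat S U) us (map \<tau> (w # ws))"
      unfolding sat_delta by auto
    have len: "length us = length (w # ws)" using list_all2_lengthD[OF types] by simp
    then have "us \<noteq> []" by auto
    have "sat R V ((w # ws) ! i) (subst1 p Bot \<psi>) \<longleftrightarrow> sat S U (us ! i) (subst1 p Bot \<psi>)"
      if "i < length (w # ws)" "\<psi> \<in> cl \<phi>" for i \<psi>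
    proof -
      have "sat S U (us ! i) (\<tau> ((w # ws) ! i))"
        using list_all2_nthD[OF types, of i] len that(1) by (simp del: list.map nth_Cons)
      then show ?thesis using that(2) \<sigma>s by (auto simp: \<tau>_def sat_type_formula)
    qed
    from chain_transfer[OF len this order_refl, where i = 0 and tr = tr] sat
    have "sat (chain_rel tr S us) (chain_val p U us) (Inl 0) \<phi>" by simp
    \<comment> \<open>To collapse by \<open>chain_map\<close>, the value of \<open>p\<close> has to
      be the preimage of \<open>U p\<close>; it contains the marked copy because the chain ends in
      \<open>U p\<close>.\<close>
    then have "sat (chain_rel tr S us)
        ((\<lambda>x. {a. chain_map us a \<in> U x})(p := {a. chain_map us a \<in> U p})) (Inl 0) \<phi>"
      unfolding chain_val_def
      by (rule additive_mono[OF \<phi> frame_chain_rel[OF S us(2)], rotated])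
         (use us(3) \<open>us \<noteq> []\<close> in \<open>simp add: last_conv_nth\<close>)
    then have "sat (chain_rel tr S us) (\<lambda>x. {a. chain_map us a \<in> U x}) (Inl 0) \<phi>"
      by (simp add: fun_upd_idem)
    then have "sat S U (us ! 0) \<phi>"
      using sat_chain_map[OF S us(2)] \<open>us \<noteq> []\<close> by simp
    then show "sat S U u \<phi>" using us(1) \<open>us \<noteq> []\<close> by (simp add: hd_conv_nth)
  qed
qed

lemma normal_additive_delta_disjunction:
  assumes \<phi>: "normal_additive_in (logic tr) p q \<phi>" "p \<noteq> q" "q \<notin> vars \<phi>"
    and X: "vars \<phi> \<subseteq> insert p X"
  shows "\<exists>\<psi>s. set \<psi>s \<subseteq> delta_formulas p X \<and> equivalent_in (logic tr) \<phi> (big_or \<psi>s)"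
proof -
  obtain \<sigma>s where \<sigma>s: "set \<sigma>s = subst1 p Bot ` cl \<phi>"
    using finite_list[of "subst1 p Bot ` cl \<phi>"] by auto
  let ?K = "type_formula \<sigma>s ` Pow (set \<sigma>s)"
  let ?D = "{delta p \<kappa> \<kappa>s |\<kappa> \<kappa>s. \<kappa> \<in> ?K \<and> set \<kappa>s \<subseteq> ?K \<and> length \<kappa>s \<le> chain_bound \<phi> \<and>
    Imp (delta p \<kappa> \<kappa>s) \<phi> \<in> logic tr}"
  have K: "?K \<subseteq> Fm X"
  proof -
    have "vars \<psi> - {p} \<subseteq> X" if "\<psi> \<in> cl \<phi>" for \<psi>
      using vars_cl[OF that] X by blast
    then show ?thesis
      unfolding Fm_def image_subset_iff mem_Collect_eq vars_type_formula \<sigma>s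
      by (simp add: vars_subst1_Bot) blast
  qed
  have "?D \<subseteq> case_prod (delta p) ` (?K \<times> {\<kappa>s. set \<kappa>s \<subseteq> ?K \<and> length \<kappa>s \<le> chain_bound \<phi>})"
    by auto
  moreover have "finite \<dots>"
    by (intro finite_imageI finite_cartesian_product finite_lists_length_le) auto
  ultimately have "finite ?D" by (rule finite_subset)
  then obtain \<psi>s where \<psi>s: "set \<psi>s = ?D" by (rule exE[OF finite_list])
  have "Iff \<phi> (big_or \<psi>s) \<in> logic tr"
  proof (rule completeness)
    fix R :: "(fm set \<times> fm set) set" and V w
    assume R: "frame tr R"
    have D_imp: "sat R V w \<phi>" if "\<exists>\<delta>\<in>?D. sat R V w \<delta>"
    proof -
      from that obtain \<delta> where \<delta>: "\<delta> \<in> ?D" "sat R V w \<delta>" ..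
      from \<delta>(1) have "Imp \<delta> \<phi> \<in> logic tr" by blast
      from soundness[OF R this, of V w] \<delta>(2) show ?thesis by simp
    qed
    have imp_D: "\<exists>\<delta>\<in>?D. sat R V w \<delta>" if sat: "sat R V w \<phi>"
    proof -
      obtain ws' where ws': "ws' \<noteq> []" "hd ws' = w" "is_chain R ws'" "last ws' \<in> V p"
        "length ws' \<le> chain_bound \<phi>"
        "sat (chain_rel tr R ws') (chain_val p V ws') (Inl 0) \<phi>"
        using bounded_chain_exists[OF \<phi> R sat] by blast
      then obtain ws where ws: "ws' = w # ws" by (cases ws') auto
      define \<tau> where "\<tau> = (\<lambda>x. type_formula \<sigma>s {\<sigma> \<in> set \<sigma>s. sat R V x \<sigma>})"
      have "\<tau> x \<in> ?K" for x by (auto simp: \<tau>_def)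
      moreover have "Imp (delta p (\<tau> w) (map \<tau> ws)) \<phi> \<in> logic tr"
        unfolding \<tau>_def by (rule chain_delta_implies[OF \<phi> \<sigma>s ws'(6)[unfolded ws]])
      moreover have "length (map \<tau> ws) \<le> chain_bound \<phi>" using ws'(5) ws by simp
      ultimately have "delta p (\<tau> w) (map \<tau> ws) \<in> ?D"
        by (intro CollectI exI conjI refl) auto
      moreover have "list_all2 (sat R V) (w # ws) (map \<tau> (w # ws))"
        unfolding list_all2_map2 by (rule list.rel_refl) (simp add: \<tau>_def sat_type_formula)
      then have "sat R V w (delta p (\<tau> w) (map \<tau> ws))"
        unfolding sat_delta using ws'(3,4) ws by (intro exI[of _ "w # ws"]) simp
      ultimately show ?thesis by (rule bexI[rotated])
    qed
    show "sat R V w (Iff \<phi> (big_or \<psi>s))"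
      unfolding sat.simps sat_big_or \<psi>s by (rule iffI[OF imp_D D_imp])
  qed
  moreover have "set \<psi>s \<subseteq> delta_formulas p X"
    unfolding \<psi>s delta_formulas_def
  proof (intro subsetI CollectI, elim CollectE exE conjE)
    fix \<delta> \<kappa> \<kappa>s
    assume "\<delta> = delta p \<kappa> \<kappa>s" "\<kappa> \<in> ?K" "set \<kappa>s \<subseteq> ?K"
    then show "\<exists>\<kappa> \<kappa>s. \<delta> = delta p \<kappa> \<kappa>s \<and> \<kappa> \<in> Fm X \<and> set \<kappa>s \<subseteq> Fm X"
      using K by (intro exI[of _ \<kappa>] exI[of _ \<kappa>s] conjI subset_trans[OF _ K] subsetD[OF K])
  qed
  ultimately show ?thesis by (auto simp: equivalent_in_def)
qed

theorem corollary5p7: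
  fixes L :: "fm set" and p q :: nat and r :: "nat list" and \<phi> :: fm
  assumes "L \<in> {logic_K, logic_GL}"
    and "p \<noteq> q" and "p \<notin> set r" and "q \<notin> set r"
    and "\<phi> \<in> Fm (insert p (set r))"
  shows "normal_additive_in L p q \<phi> \<longleftrightarrow>
    (\<exists>\<psi>s. set \<psi>s \<subseteq> delta_formulas p (set r) \<and> equivalent_in L \<phi> (big_or \<psi>s))"
proof -
  obtain tr where L: "L = logic tr"
    using assms(1) by (metis insert_iff logic_def singletonD)
  have vars: "vars \<phi> \<subseteq> insert p (set r)" using assms(5) by (simp add: Fm_def)
  then have "q \<notin> vars \<phi>" using assms(2,4) by auto
  then show ?thesis
    unfolding L using normal_additive_delta_disjunction[OF _ assms(2) _ vars]
      delta_disjunction_normal_additive[OF assms(3)] by blast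
qed

end
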